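(* Consider the general linear equation of order $n$ in Laguerre-Forsyth form $$y^{(n)}+c_{n-3}\,y^{(n-3)}+c_{n-4}\,y^{(n-4)}+\dots+c_0\,y=0,$$ and set $c_n=1$, $c_{n-1}=c_{n-2}=0$. The infinitesimal generators $X_n$ of $G_S$ and $X_n^0$ of $G_c$ have the following expressions, where $a_0,a_1,a_2,k_1$ are arbitrary constants, $h$ is an arbitrary function of $x$, and $\delta_0^k$ denotes the Kronecker delta. (a) $$\begin{aligned}X_n={}&(a_2x^2+a_1x+a_0)\,\partial_x+\left[y\left(k_1+\frac{n-1}{2}(2a_2x+a_1)\right)+h\right]\partial_y\\&+\sum_{k=0}^{n-3}\left[-(n-k)(2a_2x+a_1)c_k+a_2(k+1)(k+1-n)c_{k+1}+\delta_0^k\left(-c_k\frac{h}{y}+\sum_{j=1}^{n-k}c_{k+j}\binom{k+j}{j}\frac{h^{(j)}}{y}\right)\right]\partial_{c_k}.\end{aligned}$$ (b) $$X_n^0=(a_2x^2+a_1x+a_0)\,\partial_x+\sum_{k=0}^{n-3}\left[-(n-k)(2a_2x+a_1)c_k+a_2(k+1)(k+1-n)c_{k+1}\right]\partial_{c_k}.$$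
   Context: $G_S$ denotes the symmetry group of the general equation of the given form when the coefficients $c_0,\dots,c_{n-3}$ (arbitrary functions of $x$) are regarded as additional dependent variables besides $y$: its infinitesimal generators are the vector fields $X=\xi\partial_x+\eta\partial_y+\sum_k\phi_k\partial_{c_k}$ whose $n$-th prolongation $X^{[n]}$ annihilates $\Delta=y^{(n)}+\sum_{k=0}^{n-3}c_ky^{(k)}$ whenever $\Delta=0$. The equivalence group $G$ of the Laguerre-Forsyth form is the group of invertible point transformations $x=T(z)$, $y=\lambda\,[T'(z)]^{(n-1)/2}w(z)$ with $T$ a linear fractional transformation and $\lambda$ an arbitrary constant; its infinitesimal generator is $f(x)\partial_x+y\left(\frac{n-1}{2}f'(x)+k_1\right)\partial_y$ with $f(x)=a_2x^2+a_1x+a_0$. $G_c$ is the pseudo group of transformations induced by $G$ through its action on the coefficients of the equation; its generators are obtained from $X_n$ by imposing the minimal set of conditions under which the projection of $X_n$ on the $(x,y)$-space becomes the infinitesimal generator of $G$, and then dropping the $\partial_y$ term.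
   Formalization: In X_n, the sum over j in the ∂_{c_0} component carries a minus sign instead of the printed plus, so the h-terms are −(1/y)∑_{j=0}^n c_j h^{(j)}; the printed sign fails, e.g. n=3, h=x^3 gives X^{[3]}Δ=12 instead of 0. *)

theory Defs
  imports "HOL-Analysis.Analysis"
begin

section \<open>Jet coordinates\<close>

text \<open>
  The independent variable is \<open>x\<close>; the dependent variables are \<open>y\<close> and the coefficients
  \<open>c\<^sub>0, \<dots>, c\<^sub>n\<^sub>-\<^sub>3\<close>. \<open>Dy k\<close> stands for \<open>y\<^sup>(\<^sup>k\<^sup>)\<close> and \<open>Dc i k\<close> for the \<open>k\<close>-th derivative of \<open>c\<^sub>i\<close>.
  A point of jet space assigns a real number to every coordinate; all the functions below
  depend on finitely many coordinates only.
\<close>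

datatype jet_coord = Xvar | Dy nat | Dc nat nat

type_synonym jet = "jet_coord \<Rightarrow> real"

definition base_coords :: "nat \<Rightarrow> jet_coord set" where
  "base_coords n = {Xvar, Dy 0} \<union> {Dc i 0 | i. i \<le> n - 3}"

definition open_interval :: "real set \<Rightarrow> bool" where
  "open_interval S \<longleftrightarrow> open S \<and> is_interval S \<and> S \<noteq> {}"

text \<open>The jets lying over the open box \<open>I \<times> J \<times> K 0 \<times> \<dots> \<times> K (n - 3)\<close> of \<open>(x, y, c)\<close>-space.\<close>

definition jets_over :: "nat \<Rightarrow> real set \<Rightarrow> real set \<Rightarrow> (nat \<Rightarrow> real set) \<Rightarrow> jet set" where
  "jets_over n I J K = {p. p Xvar \<in> I \<and> p (Dy 0) \<in> J \<and> (\<forall>i\<le>n - 3. p (Dc i 0) \<in> K i)}"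

definition pd :: "jet_coord \<Rightarrow> (jet \<Rightarrow> real) \<Rightarrow> jet \<Rightarrow> real" where
  "pd v F p = deriv (\<lambda>t. F (p(v := t))) (p v)"

text \<open>Infinitely differentiable: all iterated partial derivatives exist and are continuous.\<close>

definition jet_smooth_on :: "jet set \<Rightarrow> (jet \<Rightarrow> real) \<Rightarrow> bool" where
  "jet_smooth_on M F \<longleftrightarrow>
     (\<forall>vs. continuous_on M (fold pd vs F) \<and>
           (\<forall>v. \<forall>p\<in>M. (\<lambda>t. fold pd vs F (p(v := t))) differentiable at (p v)))"

text \<open>Smooth functions of \<open>(x, y, c\<^sub>0, \<dots>, c\<^sub>n\<^sub>-\<^sub>3)\<close>.\<close>

definition base_function :: "nat \<Rightarrow> jet set \<Rightarrow> (jet \<Rightarrow> real) \<Rightarrow> bool" where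
  "base_function n M F \<longleftrightarrow>
     jet_smooth_on M F \<and>
     (\<forall>p\<in>M. \<forall>q\<in>M. (\<forall>v\<in>base_coords n. p v = q v) \<longrightarrow> F p = F q)"

definition smooth_fun_on :: "real set \<Rightarrow> (real \<Rightarrow> real) \<Rightarrow> bool" where
  "smooth_fun_on I h \<longleftrightarrow> (\<forall>j. \<forall>x\<in>I. (deriv ^^ j) h differentiable at x)"


section \<open>Vector fields and their prolongations\<close>

text \<open>
  \<open>\<xi> \<partial>\<^sub>x + \<eta> \<partial>\<^sub>y + \<Sum>\<^sub>k \<phi>\<^sub>k \<partial>\<^sub>c\<^sub>k\<close>, where only the \<open>\<phi>\<^sub>k\<close> with \<open>k \<le> n - 3\<close> are relevant.
\<close>

record vfield =
  vf_x :: "jet \<Rightarrow> real"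
  vf_y :: "jet \<Rightarrow> real"
  vf_c :: "nat \<Rightarrow> jet \<Rightarrow> real"

definition vfield_on :: "nat \<Rightarrow> jet set \<Rightarrow> vfield \<Rightarrow> bool" where
  "vfield_on n M V \<longleftrightarrow>
     base_function n M (vf_x V) \<and> base_function n M (vf_y V) \<and>
     (\<forall>k\<le>n - 3. base_function n M (vf_c V k))"

definition vfield_eq_on :: "nat \<Rightarrow> jet set \<Rightarrow> vfield \<Rightarrow> vfield \<Rightarrow> bool" where
  "vfield_eq_on n M V W \<longleftrightarrow>
     (\<forall>p\<in>M. vf_x V p = vf_x W p \<and> vf_y V p = vf_y W p \<and>
            (\<forall>k\<le>n - 3. vf_c V k p = vf_c W k p))"

text \<open>
  The total derivative with respect to \<open>x\<close>. It is only ever applied to functions of jet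
  order less than \<open>n\<close>, so the sums may stop at \<open>n\<close>.
\<close>

definition total_deriv :: "nat \<Rightarrow> (jet \<Rightarrow> real) \<Rightarrow> jet \<Rightarrow> real" where
  "total_deriv n F p =
     pd Xvar F p + (\<Sum>k\<le>n. p (Dy (Suc k)) * pd (Dy k) F p)
       + (\<Sum>i\<le>n - 3. \<Sum>k\<le>n. p (Dc i (Suc k)) * pd (Dc i k) F p)"

text \<open>
  The coefficient of \<open>\<partial>/\<partial>u\<^sub>k\<close> in the prolonged vector field, for a dependent variable with
  derivative coordinates \<open>u 0, u 1, \<dots>\<close> whose own component in the field is \<open>g\<close>.
\<close>

primrec prolong_coeff ::
  "nat \<Rightarrow> (jet \<Rightarrow> real) \<Rightarrow> (nat \<Rightarrow> jet_coord) \<Rightarrow> (jet \<Rightarrow> real) \<Rightarrow> nat \<Rightarrow> jet \<Rightarrow> real" where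
  "prolong_coeff n \<xi> u g 0 = g"
| "prolong_coeff n \<xi> u g (Suc k) =
     (\<lambda>p. total_deriv n (prolong_coeff n \<xi> u g k) p - p (u (Suc k)) * total_deriv n \<xi> p)"

text \<open>The action of the \<open>n\<close>-th prolongation of \<open>V\<close> on a function \<open>F\<close> of the \<open>n\<close>-jet.\<close>

definition prolonged :: "nat \<Rightarrow> vfield \<Rightarrow> (jet \<Rightarrow> real) \<Rightarrow> jet \<Rightarrow> real" where
  "prolonged n V F p =
     vf_x V p * pd Xvar F p
     + (\<Sum>k\<le>n. prolong_coeff n (vf_x V) Dy (vf_y V) k p * pd (Dy k) F p)
     + (\<Sum>i\<le>n - 3. \<Sum>k\<le>n. prolong_coeff n (vf_x V) (Dc i) (vf_c V i) k p * pd (Dc i k) F p)"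


section \<open>Symmetries of the general equation in Laguerre-Forsyth form\<close>

definition LF_equation :: "nat \<Rightarrow> jet \<Rightarrow> real" where
  "LF_equation n p = p (Dy n) + (\<Sum>k\<le>n - 3. p (Dc k 0) * p (Dy k))"

definition GS_generator :: "nat \<Rightarrow> jet set \<Rightarrow> vfield \<Rightarrow> bool" where
  "GS_generator n M V \<longleftrightarrow>
     vfield_on n M V \<and>
     (\<forall>p\<in>M. LF_equation n p = 0 \<longrightarrow> prolonged n V (LF_equation n) p = 0)"


section \<open>The equivalence group and the induced generators\<close>

definition linear_fractional :: "real \<Rightarrow> real \<Rightarrow> real \<Rightarrow> real \<Rightarrow> real \<Rightarrow> real" where
  "linear_fractional \<alpha> \<beta> \<gamma> \<delta> z = (\<alpha> * z + \<beta>) / (\<gamma> * z + \<delta>)"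

definition equivalence_map :: "nat \<Rightarrow> (real \<Rightarrow> real) \<Rightarrow> real \<Rightarrow> real \<times> real \<Rightarrow> real \<times> real" where
  "equivalence_map n T \<mu> = (\<lambda>(z, w). (T z, \<mu> * deriv T z powr ((real n - 1) / 2) * w))"

text \<open>
  \<open>\<xi> \<partial>\<^sub>x + \<eta> \<partial>\<^sub>y\<close> is an infinitesimal generator of the equivalence group \<open>G\<close> if it is the
  velocity at \<open>s = 0\<close> of a curve in \<open>G\<close> starting at the identity. Close to the identity
  \<open>deriv T z\<close> is positive, so that the use of \<open>powr\<close> is harmless.
\<close>

definition G_generator ::
  "nat \<Rightarrow> real set \<Rightarrow> real set \<Rightarrow> (real \<Rightarrow> real \<Rightarrow> real) \<Rightarrow> (real \<Rightarrow> real \<Rightarrow> real) \<Rightarrow> bool" where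
  "G_generator n I J \<xi> \<eta> \<longleftrightarrow>
     (\<exists>\<alpha> \<beta> \<gamma> \<delta> \<mu>.
        (\<forall>f\<in>{\<alpha>, \<beta>, \<gamma>, \<delta>, \<mu>}. f differentiable at 0) \<and>
        (\<forall>\<^sub>F s in nhds 0. \<alpha> s * \<delta> s - \<beta> s * \<gamma> s \<noteq> 0 \<and> \<mu> s \<noteq> 0) \<and>
        equivalence_map n (linear_fractional (\<alpha> 0) (\<beta> 0) (\<gamma> 0) (\<delta> 0)) (\<mu> 0) = id \<and>
        (\<forall>x\<in>I. \<forall>y\<in>J.
           ((\<lambda>s. equivalence_map n (linear_fractional (\<alpha> s) (\<beta> s) (\<gamma> s) (\<delta> s)) (\<mu> s) (x, y))
              has_vector_derivative (\<xi> x y, \<eta> x y)) (at 0)))"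

text \<open>
  The generators of \<open>G\<^sub>c\<close>: those generators of \<open>G\<^sub>S\<close> whose projection on \<open>(x, y)\<close>-space is
  an infinitesimal generator of \<open>G\<close>, with the \<open>\<partial>\<^sub>y\<close> term dropped.
\<close>

definition Gc_generator ::
  "nat \<Rightarrow> real set \<Rightarrow> real set \<Rightarrow> (nat \<Rightarrow> real set) \<Rightarrow> vfield \<Rightarrow> bool" where
  "Gc_generator n I J K W \<longleftrightarrow>
     (\<exists>V. GS_generator n (jets_over n I J K) V \<and>
        (\<exists>\<xi> \<eta>. G_generator n I J \<xi> \<eta> \<and>
           (\<forall>p\<in>jets_over n I J K.
              vf_x V p = \<xi> (p Xvar) (p (Dy 0)) \<and> vf_y V p = \<eta> (p Xvar) (p (Dy 0)))) \<and>
        vfield_eq_on n (jets_over n I J K) W (V\<lparr>vf_y := \<lambda>p. 0\<rparr>))"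


section \<open>The explicit vector fields\<close>

definition coeff_c :: "nat \<Rightarrow> nat \<Rightarrow> jet \<Rightarrow> real" where
  "coeff_c n k p = (if k = n then 1 else if k = n - 1 \<or> k = n - 2 then 0 else p (Dc k 0))"

text \<open>
  For \<open>k = 0\<close> the terms with \<open>h\<close> add up to \<open>- (h\<^sup>(\<^sup>n\<^sup>) + \<Sum>\<^sub>j c\<^sub>j h\<^sup>(\<^sup>j\<^sup>)) / y\<close>: all of them have the
  same sign, since they compensate the change of the equation under \<open>y \<mapsto> y + \<epsilon> h\<close>.
\<close>

definition Xn :: "nat \<Rightarrow> real \<Rightarrow> real \<Rightarrow> real \<Rightarrow> real \<Rightarrow> (real \<Rightarrow> real) \<Rightarrow> vfield" where
  "Xn n a0 a1 a2 k1 h =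
     \<lparr>vf_x = (\<lambda>p. a2 * (p Xvar)\<^sup>2 + a1 * p Xvar + a0),
      vf_y = (\<lambda>p. p (Dy 0) * (k1 + (real n - 1) / 2 * (2 * a2 * p Xvar + a1)) + h (p Xvar)),
      vf_c = (\<lambda>k p.
        - (real n - real k) * (2 * a2 * p Xvar + a1) * coeff_c n k p
        + a2 * (real k + 1) * (real k + 1 - real n) * coeff_c n (k + 1) p
        + (if k = 0 then 1 else 0) *
          (- coeff_c n k p * (h (p Xvar) / p (Dy 0))
           - (\<Sum>j = 1..n - k. coeff_c n (k + j) p * real ((k + j) choose j)
                                * ((deriv ^^ j) h (p Xvar) / p (Dy 0)))))\<rparr>"

definition Xn0 :: "nat \<Rightarrow> real \<Rightarrow> real \<Rightarrow> real \<Rightarrow> vfield" where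
  "Xn0 n a0 a1 a2 =
     \<lparr>vf_x = (\<lambda>p. a2 * (p Xvar)\<^sup>2 + a1 * p Xvar + a0),
      vf_y = (\<lambda>p. 0),
      vf_c = (\<lambda>k p.
        - (real n - real k) * (2 * a2 * p Xvar + a1) * coeff_c n k p
        + a2 * (real k + 1) * (real k + 1 - real n) * coeff_c n (k + 1) p)\<rparr>"

end

theory Submission
  imports Defs
begin

text \<open>
  Write the field as \<open>\<xi> \<partial>\<^sub>x + \<eta> \<partial>\<^sub>y + \<Sum>\<^sub>k \<phi>\<^sub>k \<partial>\<^sub>c\<^sub>k\<close>, let \<open>D\<close> be the total derivative and \<open>\<eta>\<^sub>k\<close> the coefficient
  of the prolongation at \<open>y\<^sup>(\<^sup>k\<^sup>)\<close>, so that \<open>\<eta>\<^sub>k\<^sub>+\<^sub>1 = D \<eta>\<^sub>k - y\<^sup>(\<^sup>k\<^sup>+\<^sup>1\<^sup>) D \<xi>\<close>. Since \<open>\<phi>\<^sub>k\<close> enters only through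
  \<open>\<phi>\<^sub>k y\<^sup>(\<^sup>k\<^sup>)\<close>, invariance of the equation reads
  \<open>\<eta>\<^sub>n + \<Sum>\<^sub>k c\<^sub>k \<eta>\<^sub>k + \<Sum>\<^sub>k \<phi>\<^sub>k y\<^sup>(\<^sup>k\<^sup>) = 0\<close> with \<open>k \<le> n - 3\<close> in both sums, at all jets on which
  the equation holds.
  
  The equation has no terms in \<open>y\<^sup>(\<^sup>n\<^sup>-\<^sup>1\<^sup>)\<close> and \<open>y\<^sup>(\<^sup>n\<^sup>-\<^sup>2\<^sup>)\<close>, and none in derivatives of the \<open>c\<^sub>i\<close>. Hence
  such a coordinate of order above \<open>n - 3\<close> can be varied freely, and only \<open>\<eta>\<^sub>n\<close> can depend on
  it: the corresponding partial derivative of \<open>\<eta>\<^sub>n\<close> vanishes (\<open>on_shell_slope_zero\<close>). These partial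
  derivatives are computed recursively, without expanding \<open>\<eta>\<^sub>n\<close>, from the commutation rules
  \<open>[\<partial>/\<partial>y\<^sup>(\<^sup>k\<^sup>+\<^sup>1\<^sup>), D] = \<partial>/\<partial>y\<^sup>(\<^sup>k\<^sup>)\<close> and \<open>[\<partial>/\<partial>y, D] = 0\<close> (\<open>pd_td\<close>), which rest on the
  symmetry of second derivatives (\<open>pd_commute\<close>).
  
  \<^item> The slope in \<open>c\<^sub>i\<^sup>(\<^sup>n\<^sup>)\<close> is \<open>\<partial>\<eta>/\<partial>c\<^sub>i - y' \<partial>\<xi>/\<partial>c\<^sub>i\<close>, so \<open>\<xi>\<close> and \<open>\<eta>\<close> depend on \<open>(x, y)\<close> only.
  \<^item> The slope in \<open>y\<^sup>(\<^sup>n\<^sup>-\<^sup>1\<^sup>)\<close>, differentiated by \<open>y''\<close>, gives \<open>\<xi>\<^sub>y = 0\<close>; differentiated by \<open>y'\<close>, it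
  then gives \<open>\<eta>\<^sub>y\<^sub>y = 0\<close>.
  \<^item> What is left of the slopes in \<open>y\<^sup>(\<^sup>n\<^sup>-\<^sup>1\<^sup>)\<close> and \<open>y\<^sup>(\<^sup>n\<^sup>-\<^sup>2\<^sup>)\<close> is \<open>n \<eta>\<^sub>y' = (n choose 2) \<xi>''\<close> and
  \<open>(n choose 2) \<eta>\<^sub>y'' = (n choose 3) \<xi>'''\<close>. Together they force \<open>\<xi>''' = 0\<close>, so \<open>\<xi>\<close> is quadratic in \<open>x\<close>
  and \<open>\<eta>\<^sub>y = k\<^sub>1 + (n - 1) / 2 \<xi>'\<close> (\<open>explicit_\<xi>_\<eta>\<close>).
  
  Conversely every explicit field is a symmetry (\<open>GS_generator_Xn\<close>), and \<open>\<phi>\<close> is determined by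
  \<open>\<xi>\<close> and \<open>\<eta>\<close>: the difference of two solutions satisfies \<open>\<Sum>\<^sub>k d\<^sub>k y\<^sup>(\<^sup>k\<^sup>) = 0\<close> with free
  \<open>y', \<dots>, y\<^sup>(\<^sup>n\<^sup>-\<^sup>3\<^sup>)\<close> and \<open>y \<noteq> 0\<close> (\<open>GS_determines_coefficients\<close>). This proves the first part without
  solving for the \<open>\<phi>\<^sub>k\<close>. For the second part, the action of \<open>G\<close> is linear in \<open>y\<close>, so a projection
  lying in the Lie algebra of \<open>G\<close> has \<open>h = 0\<close> (\<open>Gc_projection_h_zero\<close>), while a curve of linear
  fractional transformations realises every quadratic \<open>\<xi>\<close> (\<open>G_generator_quadratic\<close>).
\<close>

section \<open>Partial derivatives and smooth functions on a box of jets\<close>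

lemma fold_pd_Cons: "fold pd (v # vs) F = fold pd vs (pd v F)"
  by simp

text \<open>
  A box with an open interval for each coordinate: inside it, every coordinate can be varied
  separately, which is all that partial derivatives and their vanishing need.
\<close>

locale jet_box =
  fixes B :: "jet_coord \<Rightarrow> real set" and M :: "jet set"
  assumes interval: "open_interval (B v)"
    and box: "M = {p. \<forall>v. p v \<in> B v}"
begin

lemma open_slice: "open (B v)"
  using interval by (simp add: open_interval_def)

lemma convex_slice: "convex (B v)"
  using interval by (simp add: open_interval_def is_interval_convex_1)

lemma coord_in: "p \<in> M \<Longrightarrow> p v \<in> B v"
  by (simp add: box)

lemma upd_in_iff: "p \<in> M \<Longrightarrow> p(v := t) \<in> M \<longleftrightarrow> t \<in> B v"
  by (auto simp: box)

lemma upd_in: "p \<in> M \<Longrightarrow> t \<in> B v \<Longrightarrow> p(v := t) \<in> M"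
  by (simp add: upd_in_iff)

lemma nonempty: "\<exists>p. p \<in> M"
proof -
  have "\<forall>v. \<exists>t. t \<in> B v"
    using interval unfolding open_interval_def by blast
  then obtain p where "\<forall>v. p v \<in> B v" by metis
  then show ?thesis by (auto simp: box)
qed

lemma eventually_slice: "p \<in> M \<Longrightarrow> eventually (\<lambda>t. t \<in> B v) (nhds (p v))"
  using open_slice coord_in by (simp add: eventually_nhds_in_open)

lemma eventually_upd_in: "p \<in> M \<Longrightarrow> eventually (\<lambda>t. p(v := t) \<in> M) (nhds (p v))"
  using eventually_slice[of p v] by (simp add: upd_in_iff)

text \<open>
  Functions on jets are total, but only their values on the box matter; every operation below
  respects this equality.
\<close>

definition eqM :: "(jet \<Rightarrow> real) \<Rightarrow> (jet \<Rightarrow> real) \<Rightarrow> bool" where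
  "eqM F G \<longleftrightarrow> (\<forall>p\<in>M. F p = G p)"

lemma eqM_D: "eqM F G \<Longrightarrow> p \<in> M \<Longrightarrow> F p = G p"
  by (simp add: eqM_def)

lemma eqM_sym: "eqM F G \<Longrightarrow> eqM G F"
  by (simp add: eqM_def)

lemma eqM_trans: "eqM F G \<Longrightarrow> eqM G H \<Longrightarrow> eqM F H"
  by (simp add: eqM_def)

lemma eqM_refl: "eqM F F"
  by (simp add: eqM_def)

lemma eventually_eq_slice:
  assumes "eqM F G" "p \<in> M"
  shows "eventually (\<lambda>t. F (p(v := t)) = G (p(v := t))) (nhds (p v))"
  using eventually_upd_in[OF assms(2)] by eventually_elim (use assms(1) in \<open>simp add: eqM_def\<close>)

lemma pd_cong: "eqM F G \<Longrightarrow> p \<in> M \<Longrightarrow> pd v F p = pd v G p"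
  unfolding pd_def by (rule deriv_cong_ev[OF eventually_eq_slice]) auto

lemma eqM_pd: "eqM F G \<Longrightarrow> eqM (pd v F) (pd v G)"
  using pd_cong by (simp add: eqM_def)

lemma eqM_fold_pd: "eqM F G \<Longrightarrow> eqM (fold pd vs F) (fold pd vs G)"
proof (induction vs arbitrary: F G)
  case (Cons v vs)
  show ?case
    unfolding fold_pd_Cons by (rule Cons.IH[OF eqM_pd[OF Cons.prems]])
next
  case Nil
  then show ?case by (simp only: fold_simps)
qed

definition pdiff :: "(jet \<Rightarrow> real) \<Rightarrow> bool" where
  "pdiff F \<longleftrightarrow> continuous_on M F \<and>
     (\<forall>v. \<forall>p\<in>M. (\<lambda>t. F (p(v := t))) differentiable at (p v))"

lemma pdiff_cong: "eqM F G \<Longrightarrow> pdiff F \<Longrightarrow> pdiff G"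
proof -
  assume eq: "eqM F G" and F: "pdiff F"
  have "continuous_on M G"
    using F eq continuous_on_eq[of M F G] by (simp add: pdiff_def eqM_def)
  moreover have "(\<lambda>t. G (p(v := t))) differentiable at (p v)" if p: "p \<in> M" for p v
  proof -
    have "(\<lambda>t. F (p(v := t))) differentiable at (p v)"
      using F p by (simp add: pdiff_def)
    then obtain d where "((\<lambda>t. F (p(v := t))) has_field_derivative d) (at (p v))"
      using real_differentiableE by blast
    then have "((\<lambda>t. G (p(v := t))) has_field_derivative d) (at (p v))"
      using DERIV_cong_ev[OF refl eventually_eq_slice[OF eq p] refl] by blast
    then show ?thesis
      using real_differentiable_def by blast
  qed
  ultimately show ?thesis by (simp add: pdiff_def)
qed

lemma pdiff_DERIV:
  assumes "pdiff F" "p \<in> M"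
  shows "((\<lambda>t. F (p(v := t))) has_field_derivative pd v F p) (at (p v))"
  using assms unfolding pdiff_def pd_def by (simp add: DERIV_deriv_iff_real_differentiable)

lemma pd_eqI:
  assumes "((\<lambda>t. F (p(v := t))) has_field_derivative d) (at (p v))"
  shows "pd v F p = d"
  using assms unfolding pd_def by (rule DERIV_imp_deriv)

lemma jet_smooth_on_alt: "jet_smooth_on M F \<longleftrightarrow> (\<forall>vs. pdiff (fold pd vs F))"
  by (auto simp: jet_smooth_on_def pdiff_def)

lemma smooth_pdiff: "jet_smooth_on M F \<Longrightarrow> pdiff F"
  unfolding jet_smooth_on_alt by (metis fold_simps(1))

lemma smooth_pd: "jet_smooth_on M F \<Longrightarrow> jet_smooth_on M (pd v F)"
  unfolding jet_smooth_on_alt by (metis fold_pd_Cons)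

text \<open>
  Smoothness quantifies over all iterated derivatives. It suffices to put the function into
  some set that is closed under partial derivatives up to equality on the box.
\<close>

lemma smooth_coinduct:
  assumes "F \<in> A"
    and pdiff: "\<And>F. F \<in> A \<Longrightarrow> pdiff F"
    and closed: "\<And>F v. F \<in> A \<Longrightarrow> \<exists>G\<in>A. eqM (pd v F) G"
  shows "jet_smooth_on M F"
proof -
  have "\<exists>G\<in>A. eqM (fold pd vs F) G" if "\<exists>G\<in>A. eqM F G" for vs F
    using that
  proof (induction vs arbitrary: F)
    case (Cons v vs)
    then obtain G where "G \<in> A" "eqM F G" by blast
    with closed[of G v] have "\<exists>G\<in>A. eqM (pd v F) G"
      using eqM_pd eqM_trans by blast
    with Cons.IH show ?case by simp
  qed simp
  then have "\<exists>G\<in>A. eqM (fold pd vs F) G" for vs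
    using assms(1) eqM_refl by blast
  then show ?thesis
    unfolding jet_smooth_on_alt using pdiff pdiff_cong eqM_sym by blast
qed

lemma smooth_cong: "eqM F G \<Longrightarrow> jet_smooth_on M F \<Longrightarrow> jet_smooth_on M G"
  unfolding jet_smooth_on_alt using eqM_fold_pd pdiff_cong by blast

lemma pdiff_add: "pdiff F \<Longrightarrow> pdiff G \<Longrightarrow> pdiff (\<lambda>p. F p + G p)"
  unfolding pdiff_def by (auto intro!: continuous_intros derivative_intros)

lemma pdiff_mult: "pdiff F \<Longrightarrow> pdiff G \<Longrightarrow> pdiff (\<lambda>p. F p * G p)"
  unfolding pdiff_def by (auto intro!: continuous_intros derivative_intros)

lemma pd_add:
  "pdiff F \<Longrightarrow> pdiff G \<Longrightarrow> p \<in> M \<Longrightarrow> pd v (\<lambda>p. F p + G p) p = pd v F p + pd v G p"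
  by (rule pd_eqI) (auto intro!: derivative_eq_intros pdiff_DERIV)

lemma pd_mult:
  assumes "pdiff F" "pdiff G" "p \<in> M"
  shows "pd v (\<lambda>p. F p * G p) p = pd v F p * G p + F p * pd v G p"
proof (rule pd_eqI)
  have "((\<lambda>t. F (p(v := t)) * G (p(v := t))) has_field_derivative
          pd v F p * G (p(v := p v)) + pd v G p * F (p(v := p v))) (at (p v))"
    using assms by (intro DERIV_mult pdiff_DERIV)
  then show "((\<lambda>t. F (p(v := t)) * G (p(v := t))) has_field_derivative
          pd v F p * G p + F p * pd v G p) (at (p v))"
    by (simp add: mult.commute)
qed

lemma pd_const: "pd v (\<lambda>p. c) p = 0"
  by (rule pd_eqI) simp

lemma pdiff_const: "pdiff (\<lambda>p. c)"
  by (simp add: pdiff_def)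

text \<open>
  The set used to show that products are smooth. Products alone would not be closed under
  partial derivatives: the Leibniz rule produces sums of products.
\<close>

inductive smooth_algebra :: "(jet \<Rightarrow> real) \<Rightarrow> bool" where
  gen: "jet_smooth_on M F \<Longrightarrow> smooth_algebra F"
| add: "smooth_algebra F \<Longrightarrow> smooth_algebra G \<Longrightarrow> smooth_algebra (\<lambda>p. F p + G p)"
| mult: "smooth_algebra F \<Longrightarrow> smooth_algebra G \<Longrightarrow> smooth_algebra (\<lambda>p. F p * G p)"

lemma smooth_algebra_smooth:
  assumes "smooth_algebra F"
  shows "jet_smooth_on M F"
proof -
  have *: "pdiff F \<and> (\<forall>v. \<exists>G. smooth_algebra G \<and> eqM (pd v F) G)" if "smooth_algebra F" for F
    using that
  proof induction
    case (gen F)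
    then show ?case
      using smooth_pdiff smooth_pd smooth_algebra.gen eqM_refl by blast
  next
    case (add F G)
    show ?case
    proof (intro conjI allI)
      show "pdiff (\<lambda>p. F p + G p)" using add by (simp add: pdiff_add)
      fix v
      obtain F' G' where FG: "smooth_algebra F'" "eqM (pd v F) F'" "smooth_algebra G'" "eqM (pd v G) G'"
        using add by meson
      then have "eqM (pd v (\<lambda>p. F p + G p)) (\<lambda>p. F' p + G' p)"
        using add by (auto simp: eqM_def pd_add)
      then show "\<exists>H. smooth_algebra H \<and> eqM (pd v (\<lambda>p. F p + G p)) H"
        using smooth_algebra.add[OF FG(1,3)] by blast
    qed
  next
    case (mult F G)
    show ?case
    proof (intro conjI allI)
      show "pdiff (\<lambda>p. F p * G p)" using mult by (simp add: pdiff_mult)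
      fix v
      obtain F' G' where FG: "smooth_algebra F'" "eqM (pd v F) F'" "smooth_algebra G'" "eqM (pd v G) G'"
        using mult by meson
      then have "eqM (pd v (\<lambda>p. F p * G p)) (\<lambda>p. F' p * G p + F p * G' p)"
        using mult by (auto simp: eqM_def pd_mult)
      then show "\<exists>H. smooth_algebra H \<and> eqM (pd v (\<lambda>p. F p * G p)) H"
        using smooth_algebra.add[OF smooth_algebra.mult[OF FG(1) mult.hyps(2)]
            smooth_algebra.mult[OF mult.hyps(1) FG(3)]] by blast
    qed
  qed
  show ?thesis
  proof (rule smooth_coinduct[where A = "Collect smooth_algebra"])
    fix G v assume "G \<in> Collect smooth_algebra"
    with *[of G] show "pdiff G" "\<exists>H\<in>Collect smooth_algebra. eqM (pd v G) H"
      by blast+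
  qed (use assms in simp)
qed

lemma smooth_add: "jet_smooth_on M F \<Longrightarrow> jet_smooth_on M G \<Longrightarrow> jet_smooth_on M (\<lambda>p. F p + G p)"
  by (rule smooth_algebra_smooth[OF smooth_algebra.add[OF smooth_algebra.gen smooth_algebra.gen]])

lemma smooth_mult: "jet_smooth_on M F \<Longrightarrow> jet_smooth_on M G \<Longrightarrow> jet_smooth_on M (\<lambda>p. F p * G p)"
  by (rule smooth_algebra_smooth[OF smooth_algebra.mult[OF smooth_algebra.gen smooth_algebra.gen]])

lemma pdiff_coord:
  assumes "\<And>x. x \<in> B u \<Longrightarrow> (f has_real_derivative g x) (at x)"
  shows "pdiff (\<lambda>p. f (p u))"
    and "p \<in> M \<Longrightarrow> pd v (\<lambda>p. f (p u)) p = (if v = u then g (p u) else 0)"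
proof -
  have cont: "continuous_on (B u) f"
    using assms by (meson DERIV_isCont continuous_at_imp_continuous_on)
  have "continuous_on M (\<lambda>p. f (p u))"
    by (rule continuous_on_compose2[OF cont])
      (auto simp: coord_in intro: continuous_on_subset[OF continuous_on_product_coordinates])
  moreover have D: "((\<lambda>t. f ((p(v := t)) u)) has_real_derivative (if v = u then g (p u) else 0)) (at (p v))"
    if "p \<in> M" for p v
    using assms[OF coord_in[OF that, of u]] by auto
  ultimately show "pdiff (\<lambda>p. f (p u))"
    unfolding pdiff_def using real_differentiable_def by blast
  show "pd v (\<lambda>p. f (p u)) p = (if v = u then g (p u) else 0)" if "p \<in> M"
    by (rule pd_eqI[OF D[OF that]])
qed

text \<open>
  The coinduction principle for functions of one coordinate \<open>u\<close>: the derivatives in the other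
  directions are zero, so the zero function is adjoined to the set.
\<close>

lemma smooth_coord_fun:
  assumes "f \<in> S"
    and deriv: "\<And>f. f \<in> S \<Longrightarrow> \<exists>g\<in>S. \<forall>x\<in>B u. (f has_real_derivative g x) (at x)"
  shows "jet_smooth_on M (\<lambda>p. f (p u))"
proof (rule smooth_coinduct[where A = "insert (\<lambda>p. 0) {(\<lambda>p. f (p u)) |f. f \<in> S}"])
  show "(\<lambda>p. f (p u)) \<in> insert (\<lambda>p. 0) {(\<lambda>p. f (p u)) |f. f \<in> S}"
    using assms(1) by blast
next
  fix F assume "F \<in> insert (\<lambda>p. 0) {(\<lambda>p. f (p u)) |f. f \<in> S}"
  then consider "F = (\<lambda>p. 0)" | f where "f \<in> S" "F = (\<lambda>p. f (p u))" by blast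
  note cases = this
  from cases show "pdiff F"
  proof cases
    case (2 f)
    with deriv[of f] show ?thesis using pdiff_coord(1) by blast
  qed (simp add: pdiff_const)
  fix v
  from cases show "\<exists>G\<in>insert (\<lambda>p. 0) {(\<lambda>p. f (p u)) |f. f \<in> S}. eqM (pd v F) G"
  proof cases
    case 1
    then show ?thesis by (auto simp: eqM_def pd_const)
  next
    case (2 f)
    with deriv[of f] obtain g where g: "g \<in> S" "\<forall>x\<in>B u. (f has_real_derivative g x) (at x)"
      by blast
    show ?thesis
    proof (cases "v = u")
      case True
      then have "eqM (pd v F) (\<lambda>p. g (p u))"
        using pdiff_coord(2)[of u f g _ v] g(2) 2(2) by (auto simp: eqM_def)
      then show ?thesis using g(1) by blast
    next
      case False
      then have "eqM (pd v F) (\<lambda>p. 0)"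
        using pdiff_coord(2)[of u f g _ v] g(2) 2(2) by (auto simp: eqM_def)
      then show ?thesis by blast
    qed
  qed
qed

lemma smooth_const: "jet_smooth_on M (\<lambda>p. c)"
  using smooth_coord_fun[of "\<lambda>_. c" "range (\<lambda>c _. c)"] by (fastforce intro: derivative_eq_intros)

lemma smooth_coord: "jet_smooth_on M (\<lambda>p. p u)"
proof (rule smooth_coord_fun[where f = "\<lambda>x. x" and S = "insert (\<lambda>x. x) (range (\<lambda>c _. c))"])
  fix f :: "real \<Rightarrow> real" assume "f \<in> insert (\<lambda>x. x) (range (\<lambda>c _. c))"
  then show "\<exists>g\<in>insert (\<lambda>x. x) (range (\<lambda>c _. c)). \<forall>x\<in>B u. (f has_real_derivative g x) (at x)"
  proof
    assume "f = (\<lambda>x. x)"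
    then show ?thesis by (intro bexI[of _ "\<lambda>_. 1"]) (auto intro: derivative_eq_intros)
  next
    assume "f \<in> range (\<lambda>c _. c)"
    then show ?thesis by (intro bexI[of _ "\<lambda>_. 0"]) (auto intro: derivative_eq_intros)
  qed
qed simp

lemma pd_coord: "pd v (\<lambda>p. p u) p = (if v = u then 1 else 0)"
  by (rule pd_eqI) (cases "v = u", auto intro: derivative_eq_intros)

lemma smooth_inverse_coord:
  assumes "0 \<notin> B u"
  shows "jet_smooth_on M (\<lambda>p. inverse (p u))"
proof -
  let ?S = "range (\<lambda>(c::real, m) x. c * inverse x ^ m)"
  have "jet_smooth_on M (\<lambda>p. (\<lambda>x. 1 * inverse x ^ 1) (p u))"
  proof (rule smooth_coord_fun[where S = ?S])
    show "(\<lambda>x. 1 * inverse x ^ 1) \<in> ?S"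
      by (rule range_eqI[of _ _ "(1, 1)"]) simp
  next
    fix f :: "real \<Rightarrow> real" assume "f \<in> ?S"
    then obtain c m where f: "f = (\<lambda>x. c * inverse x ^ m)" by auto
    let ?g = "\<lambda>x. (- c * real m) * inverse x ^ (m + 1)"
    have "(f has_real_derivative ?g x) (at x)" if "x \<in> B u" for x
    proof -
      have "x \<noteq> 0" using that assms by auto
      then have "(f has_real_derivative c * (real m * inverse x ^ (m - 1) * (- (inverse x ^ 2)))) (at x)"
        unfolding f by (auto intro!: derivative_eq_intros simp: power2_eq_square)
      moreover have "c * (real m * inverse x ^ (m - 1) * (- (inverse x ^ 2))) = ?g x"
        by (cases m) (simp_all add: power2_eq_square)
      ultimately show ?thesis by (rule DERIV_cong)
    qed
    moreover have "?g \<in> ?S"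
      by (rule range_eqI[of _ _ "(- c * real m, m + 1)"]) simp
    ultimately show "\<exists>g\<in>?S. \<forall>x\<in>B u. (f has_real_derivative g x) (at x)"
      by (intro bexI[of _ ?g]) simp_all
  qed
  then show ?thesis by simp
qed

lemma smooth_fun_DERIV:
  assumes "smooth_fun_on I h" "x \<in> I"
  shows "((deriv ^^ j) h has_real_derivative (deriv ^^ Suc j) h x) (at x)"
  using assms by (simp add: smooth_fun_on_def DERIV_deriv_iff_real_differentiable)

lemma smooth_fun_coord:
  assumes "smooth_fun_on (B u) h"
  shows "jet_smooth_on M (\<lambda>p. (deriv ^^ j) h (p u))"
  by (rule smooth_coord_fun[where S = "range (\<lambda>j. (deriv ^^ j) h)"])
    (use smooth_fun_DERIV[OF assms] in blast)+

lemma pd_fun_coord: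
  assumes "smooth_fun_on (B u) h" "p \<in> M"
  shows "pd v (\<lambda>p. (deriv ^^ j) h (p u)) p = (if v = u then (deriv ^^ Suc j) h (p u) else 0)"
  using pdiff_coord(2)[OF smooth_fun_DERIV[OF assms(1)] assms(2)] by simp

text \<open>
  Half of the classical proof that mixed partial derivatives agree: the mean value theorem,
  applied first in direction \<open>u\<close> and then in direction \<open>v\<close>. The left-hand side is symmetric in
  \<open>u\<close> and \<open>v\<close>.
\<close>

lemma second_difference:
  assumes F: "jet_smooth_on M F" and p: "p \<in> M" and uv: "u \<noteq> v" and h: "0 < h"
    and Bu: "{p u..p u + h} \<subseteq> B u" and Bv: "{p v..p v + h} \<subseteq> B v"
  shows "\<exists>s t. p u < s \<and> s < p u + h \<and> p v < t \<and> t < p v + h \<and>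
     F (p(u := p u + h, v := p v + h)) - F (p(u := p u + h)) - F (p(v := p v + h)) + F p
       = h * h * pd v (pd u F) (p(u := s, v := t))"
proof -
  have in_M: "p(u := s, v := t) \<in> M" if "s \<in> {p u..p u + h}" "t \<in> {p v..p v + h}" for s t
    using that p Bu Bv uv by (auto simp: box)
  have du: "((\<lambda>s. F (p(u := s, v := t))) has_real_derivative pd u F (p(u := s, v := t))) (at s)"
    if "s \<in> {p u..p u + h}" "t \<in> {p v..p v + h}" for s t
    using pdiff_DERIV[OF smooth_pdiff[OF F] in_M[OF that], of u] uv
    by (simp add: fun_upd_twist)
  have dv: "((\<lambda>t. pd u F (p(u := s, v := t))) has_real_derivative pd v (pd u F) (p(u := s, v := t))) (at t)"
    if "s \<in> {p u..p u + h}" "t \<in> {p v..p v + h}" for s t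
    using pdiff_DERIV[OF smooth_pdiff[OF smooth_pd[OF F]] in_M[OF that], of u v] uv
    by simp
  let ?g = "\<lambda>s. F (p(u := s, v := p v + h)) - F (p(u := s, v := p v))"
  let ?g' = "\<lambda>s. pd u F (p(u := s, v := p v + h)) - pd u F (p(u := s, v := p v))"
  have "\<exists>s. p u < s \<and> s < p u + h \<and> ?g (p u + h) - ?g (p u) = (p u + h - p u) * ?g' s"
  proof (rule MVT2)
    show "(?g has_real_derivative ?g' s) (at s)" if "p u \<le> s" "s \<le> p u + h" for s
      by (intro DERIV_diff du) (use that h in auto)
  qed (use h in simp)
  then obtain s where s: "p u < s" "s < p u + h" "?g (p u + h) - ?g (p u) = h * ?g' s"
    by auto
  have "\<exists>t. p v < t \<and> t < p v + h \<and> ?g' s = (p v + h - p v) * pd v (pd u F) (p(u := s, v := t))"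
  proof (rule MVT2)
    show "((\<lambda>t. pd u F (p(u := s, v := t))) has_real_derivative pd v (pd u F) (p(u := s, v := t))) (at t)"
      if "p v \<le> t" "t \<le> p v + h" for t
      by (rule dv) (use that s in auto)
  qed (use h in simp)
  then obtain t where t: "p v < t" "t < p v + h" "?g' s = h * pd v (pd u F) (p(u := s, v := t))"
    by auto
  have "p(u := p u + h, v := p v) = p(u := p u + h)"
    using uv by auto
  then have "F (p(u := p u + h, v := p v + h)) - F (p(u := p u + h)) - F (p(v := p v + h)) + F p
       = h * h * pd v (pd u F) (p(u := s, v := t))"
    using s(3) t(3) by simp
  with s t show ?thesis by blast
qed

text \<open>
  In the product topology the point \<open>p(u := s, v := t)\<close> depends continuously on \<open>(s, t)\<close>, so continuity
  on jet space yields continuity in these two coordinates jointly.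
\<close>

lemma continuous_near:
  fixes G :: "jet \<Rightarrow> real"
  assumes G: "continuous_on M G" and p: "p \<in> M" and e: "e > 0" and uv: "u \<noteq> v"
  shows "\<exists>d>0. \<forall>s t. \<bar>s - p u\<bar> < d \<longrightarrow> \<bar>t - p v\<bar> < d \<longrightarrow> \<bar>G (p(u := s, v := t)) - G p\<bar> < e"
proof -
  let ?U = "B u \<times> B v" and ?\<phi> = "\<lambda>z. p(u := fst z, v := snd z)"
  have "continuous_on ?U ?\<phi>"
  proof (rule continuous_on_coordinatewise_then_product)
    fix w
    show "continuous_on ?U (\<lambda>z. (p(u := fst z, v := snd z)) w)"
      by (cases "w = v"; cases "w = u") (auto intro!: continuous_intros)
  qed
  moreover have "?\<phi> ` ?U \<subseteq> M"
    using p by (auto simp: box)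
  ultimately have "continuous_on ?U (\<lambda>z. G (?\<phi> z))"
    using continuous_on_compose2[OF G] by blast
  moreover have "open ?U" using open_slice by (intro open_Times)
  moreover have "(p u, p v) \<in> ?U" using p coord_in by auto
  ultimately have "isCont (\<lambda>z. G (?\<phi> z)) (p u, p v)"
    using continuous_on_eq_continuous_at by blast
  then obtain d where d: "d > 0"
    "\<And>z. dist z (p u, p v) < d \<Longrightarrow> dist (G (?\<phi> z)) (G (?\<phi> (p u, p v))) < e"
    using e unfolding continuous_at_eps_delta by blast
  show ?thesis
  proof (intro exI[of _ "d / 2"] conjI allI impI)
    fix s t assume st: "\<bar>s - p u\<bar> < d / 2" "\<bar>t - p v\<bar> < d / 2"
    have "dist (s, t) (p u, p v) \<le> \<bar>s - p u\<bar> + \<bar>t - p v\<bar>"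
      unfolding dist_prod_def by (simp add: dist_real_def sqrt_sum_squares_le_sum_abs)
    also have "\<dots> < d" using st by simp
    finally show "\<bar>G (p(u := s, v := t)) - G p\<bar> < e"
      using d(2)[of "(s, t)"] by (simp add: dist_real_def)
  qed (use d in simp)
qed

text \<open>
  Both mixed derivatives represent the same second difference at points of an arbitrarily small
  square; by continuity their values at its corner agree.
\<close>

lemma pd_commute:
  assumes F: "jet_smooth_on M F" and p: "p \<in> M"
  shows "pd u (pd v F) p = pd v (pd u F) p"
proof (cases "u = v")
  case uv: False
  show ?thesis
  proof (rule ccontr)
    let ?X = "pd u (pd v F)" and ?Y = "pd v (pd u F)"
    assume "?X p \<noteq> ?Y p"
    define e where "e = \<bar>?X p - ?Y p\<bar> / 2"
    have e: "e > 0" and e2: "\<bar>?X p - ?Y p\<bar> = 2 * e"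
      using \<open>?X p \<noteq> ?Y p\<close> by (auto simp: e_def)
    have cont: "continuous_on M ?X" "continuous_on M ?Y"
      using smooth_pdiff[OF smooth_pd[OF smooth_pd[OF F]]] by (auto simp: pdiff_def)
    obtain d1 where d1: "d1 > 0" "\<And>t s. \<bar>t - p v\<bar> < d1 \<Longrightarrow> \<bar>s - p u\<bar> < d1 \<Longrightarrow>
        \<bar>?X (p(v := t, u := s)) - ?X p\<bar> < e"
      using continuous_near[OF cont(1) p e] uv by metis
    obtain d2 where d2: "d2 > 0" "\<And>s t. \<bar>s - p u\<bar> < d2 \<Longrightarrow> \<bar>t - p v\<bar> < d2 \<Longrightarrow>
        \<bar>?Y (p(u := s, v := t)) - ?Y p\<bar> < e"
      using continuous_near[OF cont(2) p e uv] by metis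
    obtain d3 where d3: "d3 > 0" "ball (p u) d3 \<subseteq> B u"
      using open_slice[of u] coord_in[OF p, of u] open_contains_ball by blast
    obtain d4 where d4: "d4 > 0" "ball (p v) d4 \<subseteq> B v"
      using open_slice[of v] coord_in[OF p, of v] open_contains_ball by blast
    \<comment> \<open>small enough for both continuity estimates and for the square to stay inside the box\<close>
    define h where "h = min (min d1 d2) (min d3 d4) / 2"
    have h: "0 < h" "h < d1" "h < d2" "h < d3" "h < d4"
      using d1(1) d2(1) d3(1) d4(1) by (auto simp: h_def)
    have Bu: "{p u..p u + h} \<subseteq> B u"
      using d3(2) h(4) by (force simp: ball_def dist_real_def)
    have Bv: "{p v..p v + h} \<subseteq> B v"
      using d4(2) h(5) by (force simp: ball_def dist_real_def)
    obtain s t where st: "p u < s" "s < p u + h" "p v < t" "t < p v + h"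
      "F (p(u := p u + h, v := p v + h)) - F (p(u := p u + h)) - F (p(v := p v + h)) + F p
       = h * h * ?Y (p(u := s, v := t))"
      using second_difference[OF F p uv h(1) Bu Bv] by blast
    obtain t' s' where st': "p v < t'" "t' < p v + h" "p u < s'" "s' < p u + h"
      "F (p(v := p v + h, u := p u + h)) - F (p(v := p v + h)) - F (p(u := p u + h)) + F p
       = h * h * ?X (p(v := t', u := s'))"
      using second_difference[OF F p uv[symmetric] h(1) Bv Bu] by blast
    have twist: "p(v := p v + h, u := p u + h) = p(u := p u + h, v := p v + h)"
      using uv by (simp add: fun_upd_twist)
    have "h * h * ?X (p(v := t', u := s')) = h * h * ?Y (p(u := s, v := t))"
      using st(5) st'(5)[unfolded twist] by linarith
    then have "?X (p(v := t', u := s')) = ?Y (p(u := s, v := t))"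
      using h(1) by simp
    moreover have "\<bar>?X (p(v := t', u := s')) - ?X p\<bar> < e"
      using d1(2)[of t' s'] st' h by auto
    moreover have "\<bar>?Y (p(u := s, v := t)) - ?Y p\<bar> < e"
      using d2(2)[of s t] st h by auto
    ultimately show False using e2 by linarith
  qed
qed simp

lemma smooth_diff:
  assumes "jet_smooth_on M F" "jet_smooth_on M G"
  shows "jet_smooth_on M (\<lambda>p. F p - G p)"
  using smooth_add[OF assms(1) smooth_mult[OF smooth_const[of "-1"] assms(2)]] by simp

lemma smooth_sum:
  assumes "\<And>i. i \<in> S \<Longrightarrow> jet_smooth_on M (F i)"
  shows "jet_smooth_on M (\<lambda>p. \<Sum>i\<in>S. F i p)"
  using assms
  by (induction S rule: infinite_finite_induct) (simp_all add: smooth_const smooth_add)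

lemma pd_smooth_add:
  "jet_smooth_on M F \<Longrightarrow> jet_smooth_on M G \<Longrightarrow> p \<in> M \<Longrightarrow>
    pd v (\<lambda>p. F p + G p) p = pd v F p + pd v G p"
  by (simp add: pd_add smooth_pdiff)

lemma pd_smooth_mult:
  "jet_smooth_on M F \<Longrightarrow> jet_smooth_on M G \<Longrightarrow> p \<in> M \<Longrightarrow>
    pd v (\<lambda>p. F p * G p) p = pd v F p * G p + F p * pd v G p"
  by (simp add: pd_mult smooth_pdiff)

lemma pd_smooth_diff:
  assumes "jet_smooth_on M F" "jet_smooth_on M G" "p \<in> M"
  shows "pd v (\<lambda>p. F p - G p) p = pd v F p - pd v G p"
proof -
  have "pd v (\<lambda>p. F p + (-1) * G p) p = pd v F p + pd v (\<lambda>p. (-1) * G p) p"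
    by (rule pd_smooth_add[OF assms(1) smooth_mult[OF smooth_const assms(2)] assms(3)])
  also have "pd v (\<lambda>p. (-1) * G p) p = - pd v G p"
    using pd_smooth_mult[OF smooth_const[of "-1"] assms(2,3), of v] by (simp add: pd_const)
  finally show ?thesis by simp
qed

lemma pd_smooth_sum:
  assumes "\<And>i. i \<in> S \<Longrightarrow> jet_smooth_on M (F i)" "p \<in> M"
  shows "pd v (\<lambda>p. \<Sum>i\<in>S. F i p) p = (\<Sum>i\<in>S. pd v (F i) p)"
  using assms(1)
  by (induction S rule: infinite_finite_induct)
    (simp_all add: pd_const pd_smooth_add smooth_sum assms(2))

section \<open>Functions of selected jet coordinates\<close>

text \<open>
  The set \<open>C\<close> only bounds the coordinates on which the function depends; it need not be minimal.
  Keeping track of it is what makes most partial derivatives in the recursions below vanish.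
\<close>

definition jfun :: "jet_coord set \<Rightarrow> (jet \<Rightarrow> real) \<Rightarrow> bool" where
  "jfun C F \<longleftrightarrow> jet_smooth_on M F \<and>
     (\<forall>p\<in>M. \<forall>q\<in>M. (\<forall>v\<in>C. p v = q v) \<longrightarrow> F p = F q)"

lemma jfun_smooth: "jfun C F \<Longrightarrow> jet_smooth_on M F"
  by (simp add: jfun_def)

lemma jfun_eq: "jfun C F \<Longrightarrow> p \<in> M \<Longrightarrow> q \<in> M \<Longrightarrow> (\<And>v. v \<in> C \<Longrightarrow> p v = q v) \<Longrightarrow> F p = F q"
  unfolding jfun_def by blast

lemma jfunI:
  assumes "jet_smooth_on M F"
    and "\<And>p q. p \<in> M \<Longrightarrow> q \<in> M \<Longrightarrow> \<forall>v\<in>C. p v = q v \<Longrightarrow> F p = F q"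
  shows "jfun C F"
  using assms unfolding jfun_def by blast

lemma jfun_upd: "jfun C F \<Longrightarrow> p \<in> M \<Longrightarrow> t \<in> B v \<Longrightarrow> v \<notin> C \<Longrightarrow> F (p(v := t)) = F p"
  by (rule jfun_eq[of C F]) (auto simp: upd_in)

lemma jfun_mono: "jfun C F \<Longrightarrow> C \<subseteq> C' \<Longrightarrow> jfun C' F"
  unfolding jfun_def by blast

lemma jfun_cong: "jfun C F \<Longrightarrow> eqM F G \<Longrightarrow> jfun C G"
proof (rule jfunI)
  assume F: "jfun C F" and eq: "eqM F G"
  show "jet_smooth_on M G" by (rule smooth_cong[OF eq jfun_smooth[OF F]])
  fix p q assume pq: "p \<in> M" "q \<in> M" "\<forall>v\<in>C. p v = q v"
  then have "F p = F q" using jfun_eq[OF F] by blast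
  then show "G p = G q" using eqM_D[OF eq] pq by simp
qed

lemma jfun_const: "jfun C (\<lambda>p. c)"
  by (simp add: jfun_def smooth_const)

lemma jfun_coord: "v \<in> C \<Longrightarrow> jfun C (\<lambda>p. p v)"
  by (simp add: jfun_def smooth_coord)

lemma jfun_fun_coord:
  "v \<in> C \<Longrightarrow> smooth_fun_on (B v) h \<Longrightarrow> jfun C (\<lambda>p. (deriv ^^ j) h (p v))"
  by (simp add: jfun_def smooth_fun_coord)

lemma jfun_add: "jfun C F \<Longrightarrow> jfun C G \<Longrightarrow> jfun C (\<lambda>p. F p + G p)"
  by (rule jfunI[OF smooth_add[OF jfun_smooth jfun_smooth]]) (assumption+, metis jfun_eq)

lemma jfun_diff: "jfun C F \<Longrightarrow> jfun C G \<Longrightarrow> jfun C (\<lambda>p. F p - G p)"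
  by (rule jfunI[OF smooth_diff[OF jfun_smooth jfun_smooth]]) (assumption+, metis jfun_eq)

lemma jfun_mult: "jfun C F \<Longrightarrow> jfun C G \<Longrightarrow> jfun C (\<lambda>p. F p * G p)"
  by (rule jfunI[OF smooth_mult[OF jfun_smooth jfun_smooth]]) (assumption+, metis jfun_eq)

lemma jfun_sum: "(\<And>i. i \<in> S \<Longrightarrow> jfun C (F i)) \<Longrightarrow> jfun C (\<lambda>p. \<Sum>i\<in>S. F i p)"
  by (induction S rule: infinite_finite_induct) (simp_all add: jfun_const jfun_add)

lemma pd_absent: "jfun C F \<Longrightarrow> v \<notin> C \<Longrightarrow> p \<in> M \<Longrightarrow> pd v F p = 0"
proof -
  assume F: "jfun C F" "v \<notin> C" "p \<in> M"
  have "eventually (\<lambda>t. F (p(v := t)) = F p) (nhds (p v))"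
    using eventually_slice[OF F(3), of v]
    by eventually_elim (use jfun_upd[OF F(1,3) _ F(2)] in auto)
  then have "deriv (\<lambda>t. F (p(v := t))) (p v) = deriv (\<lambda>t. F p) (p v)"
    by (rule deriv_cong_ev) simp
  then show "pd v F p = 0" by (simp add: pd_def)
qed

lemma jfun_pd: "jfun C F \<Longrightarrow> jfun C (pd v F)"
proof (cases "v \<in> C")
  case True
  assume F: "jfun C F"
  have "pd v F p = pd v F q" if pq: "p \<in> M" "q \<in> M" "\<forall>v\<in>C. p v = q v" for p q
  proof -
    have pv: "p v = q v" using pq True by blast
    have "eventually (\<lambda>t. F (p(v := t)) = F (q(v := t))) (nhds (p v))"
      using eventually_slice[OF pq(1), of v]
    proof eventually_elim
      case (elim t)
      with pq pv have "p(v := t) \<in> M" "q(v := t) \<in> M" by (simp_all add: upd_in)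
      then show ?case
        by (rule jfun_eq[OF F]) (use pq(3) in simp)
    qed
    then show ?thesis
      unfolding pd_def by (rule deriv_cong_ev) (rule pv)
  qed
  then show ?thesis
    by (rule jfunI[OF smooth_pd[OF jfun_smooth[OF F]]])
next
  case False
  assume F: "jfun C F"
  with False have "eqM (\<lambda>p. 0) (pd v F)"
    by (simp add: eqM_def pd_absent)
  then show ?thesis by (rule jfun_cong[OF jfun_const])
qed

text \<open>
  The slice of the box in direction \<open>v\<close> is an interval, so a vanishing partial derivative makes the
  function constant along it.
\<close>

lemma jfun_drop:
  assumes F: "jfun C F" and zero: "\<And>p. p \<in> M \<Longrightarrow> pd v F p = 0"
  shows "jfun (C - {v}) F"
proof -
  have "F p = F q" if pq: "p \<in> M" "q \<in> M" "\<forall>w\<in>C - {v}. p w = q w" for p q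
  proof -
    have D: "((\<lambda>t. F (p(v := t))) has_real_derivative 0) (at t)" if "t \<in> B v" for t
    proof -
      have "p(v := t) \<in> M" using that pq upd_in by blast
      then show ?thesis
        using pdiff_DERIV[OF smooth_pdiff[OF jfun_smooth[OF F]], of "p(v := t)" v]
          zero[of "p(v := t)"] by simp
    qed
    then have "\<exists>c. \<forall>t\<in>B v. F (p(v := t)) = c"
      using has_field_derivative_zero_constant[OF convex_slice] has_field_derivative_at_within
      by blast
    then have "F (p(v := p v)) = F (p(v := q v))"
      using pq coord_in by metis
    also have "\<dots> = F q"
    proof (rule jfun_eq[OF F])
      show "p(v := q v) \<in> M" using pq upd_in coord_in by blast
      show "(p(v := q v)) w = q w" if "w \<in> C" for w using that pq(3) by simp
    qed (rule pq)
    finally show ?thesis by simp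
  qed
  then show ?thesis by (rule jfunI[OF jfun_smooth[OF F]])
qed

section \<open>The total derivative as a derivation\<close>

lemma td_cong: "eqM F G \<Longrightarrow> eqM (total_deriv n F) (total_deriv n G)"
  using pd_cong[of F G] by (simp add: total_deriv_def eqM_def)

lemma td_cong': "eqM F G \<Longrightarrow> p \<in> M \<Longrightarrow> total_deriv n F p = total_deriv n G p"
  using td_cong by (simp add: eqM_def)

lemma td_const: "total_deriv n (\<lambda>p. c) p = 0"
  by (simp add: total_deriv_def pd_const)

lemma td_add:
  assumes "jet_smooth_on M F" "jet_smooth_on M G" "p \<in> M"
  shows "total_deriv n (\<lambda>p. F p + G p) p = total_deriv n F p + total_deriv n G p"
  using assms by (simp add: total_deriv_def pd_smooth_add algebra_simps sum.distrib)

lemma td_diff: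
  assumes "jet_smooth_on M F" "jet_smooth_on M G" "p \<in> M"
  shows "total_deriv n (\<lambda>p. F p - G p) p = total_deriv n F p - total_deriv n G p"
  using assms by (simp add: total_deriv_def pd_smooth_diff algebra_simps sum_subtractf)

lemma td_mult:
  assumes "jet_smooth_on M F" "jet_smooth_on M G" "p \<in> M"
  shows "total_deriv n (\<lambda>p. F p * G p) p = total_deriv n F p * G p + F p * total_deriv n G p"
  using assms
  by (simp add: total_deriv_def pd_smooth_mult algebra_simps sum.distrib sum_distrib_left)

lemma td_Xvar: "total_deriv n (\<lambda>p. p Xvar) p = 1"
  by (simp add: total_deriv_def pd_coord)

lemma td_Dy: "k \<le> n \<Longrightarrow> total_deriv n (\<lambda>p. p (Dy k)) p = p (Dy (Suc k))"
  by (simp add: total_deriv_def pd_coord if_distrib[of "\<lambda>x. _ * x"] sum.delta cong: if_cong)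

lemma smooth_td: "jet_smooth_on M F \<Longrightarrow> jet_smooth_on M (total_deriv n F)"
  unfolding total_deriv_def
  by (intro smooth_add smooth_sum smooth_mult smooth_coord smooth_pd)

text \<open>
  The coordinates that can occur in the total derivative of a function of the coordinates \<open>C\<close>.
\<close>

definition lift :: "jet_coord set \<Rightarrow> jet_coord set" where
  "lift C = C \<union> {Dy (Suc k) |k. Dy k \<in> C} \<union> {Dc i (Suc k) |i k. Dc i k \<in> C}"

lemma jfun_td:
  assumes F: "jfun C F" and C': "lift C \<subseteq> C'"
  shows "jfun C' (total_deriv n F)"
proof -
  have "total_deriv n F p = total_deriv n F q"
    if pq: "p \<in> M" "q \<in> M" "\<forall>v\<in>C'. p v = q v" for p q
  proof -
    have pd_eq: "pd v F p = pd v F q" for v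
      by (rule jfun_eq[OF jfun_pd[OF F]]) (use pq C' in \<open>auto simp: lift_def\<close>)
    have "p (Dy (Suc k)) * pd (Dy k) F p = q (Dy (Suc k)) * pd (Dy k) F q" for k
    proof (cases "Dy k \<in> C")
      case True
      then have "Dy (Suc k) \<in> C'" using C' by (auto simp: lift_def)
      then show ?thesis using pd_eq pq by simp
    next
      case False
      then show ?thesis using pd_absent[OF F] pq by simp
    qed
    moreover have "p (Dc i (Suc k)) * pd (Dc i k) F p = q (Dc i (Suc k)) * pd (Dc i k) F q" for i k
    proof (cases "Dc i k \<in> C")
      case True
      then have "Dc i (Suc k) \<in> C'" using C' by (auto simp: lift_def)
      then show ?thesis using pd_eq pq by simp
    next
      case False
      then show ?thesis using pd_absent[OF F] pq by simp
    qed
    ultimately show ?thesis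
      unfolding total_deriv_def pd_eq[of Xvar] by (simp only:)
  qed
  then show ?thesis
    by (rule jfunI[OF smooth_td[OF jfun_smooth[OF F]]])
qed

text \<open>
  The commutator of a partial derivative with the total derivative: second derivatives are
  symmetric, so the only extra terms come from the factors \<open>y\<^sup>(\<^sup>k\<^sup>+\<^sup>1\<^sup>)\<close> and \<open>c\<^sub>i\<^sup>(\<^sup>k\<^sup>+\<^sup>1\<^sup>)\<close> of the sums.
\<close>

lemma pd_td:
  assumes F: "jet_smooth_on M F" and p: "p \<in> M"
  shows "pd v (total_deriv n F) p = total_deriv n (pd v F) p
    + (\<Sum>k\<le>n. if v = Dy (Suc k) then pd (Dy k) F p else 0)
    + (\<Sum>i\<le>n - 3. \<Sum>k\<le>n. if v = Dc i (Suc k) then pd (Dc i k) F p else 0)"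
proof -
  note [simp] = smooth_coord smooth_pd smooth_mult smooth_sum smooth_add F
  have summand: "pd v (\<lambda>p. p w * pd u F p) p
      = p w * pd u (pd v F) p + (if v = w then pd u F p else 0)" for u w
    using p by (simp add: pd_smooth_mult pd_coord pd_commute)
  have "pd v (total_deriv n F) p = pd v (pd Xvar F) p
      + (\<Sum>k\<le>n. pd v (\<lambda>p. p (Dy (Suc k)) * pd (Dy k) F p) p)
      + (\<Sum>i\<le>n - 3. \<Sum>k\<le>n. pd v (\<lambda>p. p (Dc i (Suc k)) * pd (Dc i k) F p) p)"
    unfolding total_deriv_def using p by (simp add: pd_smooth_add pd_smooth_sum)
  then show ?thesis
    unfolding summand using pd_commute[OF F p, of v Xvar]
    by (simp add: total_deriv_def sum.distrib)
qed

lemma pd_Dy_0_td: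
  "jet_smooth_on M F \<Longrightarrow> p \<in> M \<Longrightarrow> pd (Dy 0) (total_deriv n F) p = total_deriv n (pd (Dy 0) F) p"
  by (simp add: pd_td)

lemma pd_Dy_Suc_td:
  "jet_smooth_on M F \<Longrightarrow> p \<in> M \<Longrightarrow> k \<le> n \<Longrightarrow>
    pd (Dy (Suc k)) (total_deriv n F) p = total_deriv n (pd (Dy (Suc k)) F) p + pd (Dy k) F p"
  by (simp add: pd_td)

lemma pd_Dc_Suc_td:
  assumes "jet_smooth_on M F" "p \<in> M" "i \<le> n - 3" "k \<le> n"
  shows "pd (Dc i (Suc k)) (total_deriv n F) p
    = total_deriv n (pd (Dc i (Suc k)) F) p + pd (Dc i k) F p"
proof -
  have "(\<Sum>j\<le>n - 3. \<Sum>l\<le>n. if Dc i (Suc k) = Dc j (Suc l) then pd (Dc j l) F p else 0)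
      = (\<Sum>j\<le>n - 3. if j = i then pd (Dc i k) F p else 0)"
    using assms(4) by (intro sum.cong refl) auto
  then show ?thesis using assms by (simp add: pd_td)
qed

end

section \<open>Jet order and prolongation\<close>

primrec jet_order :: "jet_coord \<Rightarrow> nat" where
  "jet_order Xvar = 0"
| "jet_order (Dy k) = k"
| "jet_order (Dc i k) = k"

abbreviation order_le :: "nat \<Rightarrow> jet_coord set" where
  "order_le m \<equiv> {v. jet_order v \<le> m}"

lemma base_coords_order: "base_coords n \<subseteq> order_le 0"
  by (auto simp: base_coords_def)

context jet_box
begin

lemma lift_order_le: "lift (order_le k) \<subseteq> order_le (Suc k)"
  by (auto simp: lift_def)

lemma jfun_td_order: "jfun (order_le k) F \<Longrightarrow> jfun (order_le (Suc k)) (total_deriv n F)"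
  by (rule jfun_td[OF _ lift_order_le])

lemma td_pd_absent: "jfun C F \<Longrightarrow> v \<notin> C \<Longrightarrow> p \<in> M \<Longrightarrow> total_deriv n (pd v F) p = 0"
  using td_cong'[of "pd v F" "\<lambda>p. 0" p n] by (simp add: eqM_def pd_absent td_const)

lemma jfun_drop_set:
  assumes "finite S" "jfun C F" "\<And>v p. v \<in> S \<Longrightarrow> p \<in> M \<Longrightarrow> pd v F p = 0"
  shows "jfun (C - S) F"
  using assms(1,3)
proof (induction S)
  case (insert v S)
  have "jfun ((C - S) - {v}) F"
    by (rule jfun_drop) (use insert in auto)
  moreover have "(C - S) - {v} = C - insert v S" by blast
  ultimately show ?case by simp
qed (simp add: assms(2))

lemma td_xy:
  assumes F: "jfun {Xvar, Dy 0} F" and p: "p \<in> M"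
  shows "total_deriv n F p = pd Xvar F p + p (Dy 1) * pd (Dy 0) F p"
proof -
  have "(\<Sum>k\<le>n. p (Dy (Suc k)) * pd (Dy k) F p)
      = (\<Sum>k\<le>n. if k = 0 then p (Dy 1) * pd (Dy 0) F p else 0)"
    by (rule sum.cong) (auto simp: pd_absent[OF F _ p])
  then show ?thesis
    by (simp add: total_deriv_def pd_absent[OF F _ p])
qed

lemma td_x: "jfun {Xvar} F \<Longrightarrow> p \<in> M \<Longrightarrow> total_deriv n F p = pd Xvar F p"
  using td_xy[of F p n] jfun_mono[of "{Xvar}" F "{Xvar, Dy 0}"] pd_absent[of "{Xvar}" F "Dy 0" p]
  by simp

lemma smooth_prolong:
  assumes "jet_smooth_on M \<xi>" "jet_smooth_on M \<eta>"
  shows "jet_smooth_on M (prolong_coeff n \<xi> u \<eta> k)"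
proof (induction k)
  case (Suc k)
  then show ?case
    unfolding prolong_coeff.simps
    by (intro smooth_diff smooth_mult smooth_coord smooth_td assms(1))
qed (simp add: assms)

lemma jfun_prolong:
  assumes \<xi>: "jfun (order_le 0) \<xi>" and \<eta>: "jfun (order_le 0) \<eta>"
  shows "jfun (order_le k) (prolong_coeff n \<xi> Dy \<eta> k)"
proof (induction k)
  case (Suc k)
  have "jfun (order_le (Suc k)) (total_deriv n \<xi>)"
    by (rule jfun_mono[OF jfun_td_order[OF \<xi>]]) auto
  then show ?case
    unfolding prolong_coeff.simps
    by (intro jfun_diff jfun_mult jfun_coord jfun_td_order[OF Suc]) auto
qed (use \<eta> in simp)

lemma pd_prolong_Suc:
  assumes \<xi>: "jet_smooth_on M \<xi>" and \<eta>: "jet_smooth_on M \<eta>" and p: "p \<in> M"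
  shows "pd v (prolong_coeff n \<xi> Dy \<eta> (Suc k)) p
    = pd v (total_deriv n (prolong_coeff n \<xi> Dy \<eta> k)) p
      - (if v = Dy (Suc k) then total_deriv n \<xi> p else 0)
      - p (Dy (Suc k)) * pd v (total_deriv n \<xi>) p"
proof -
  note smooth = smooth_td[OF smooth_prolong[OF \<xi> \<eta>]] smooth_td[OF \<xi>] smooth_coord smooth_mult
  show ?thesis
    unfolding prolong_coeff.simps using p
    by (simp add: pd_smooth_diff pd_smooth_mult smooth pd_coord del: One_nat_def)
qed

end

section \<open>The symmetry condition for the Laguerre-Forsyth equation\<close>

locale LF_box = jet_box +
  fixes n :: nat
  assumes n_ge_3: "n \<ge> 3"
    and free_Dy: "B (Dy (Suc k)) = UNIV"
    and free_Dc: "B (Dc i (Suc k)) = UNIV"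
    and Dy_0_nonzero: "0 \<notin> B (Dy 0)"
begin

lemma pd_LF:
  assumes "p \<in> M"
  shows "pd v (LF_equation n) p = (if v = Dy n then 1 else 0)
    + (\<Sum>k\<le>n - 3. (if v = Dc k 0 then p (Dy k) else 0) + (if v = Dy k then p (Dc k 0) else 0))"
proof -
  have "pd v (LF_equation n) p
      = pd v (\<lambda>p. p (Dy n)) p + pd v (\<lambda>p. \<Sum>k\<le>n - 3. p (Dc k 0) * p (Dy k)) p"
    unfolding LF_equation_def using assms
    by (intro pd_smooth_add smooth_sum smooth_mult smooth_coord)
  also have "pd v (\<lambda>p. \<Sum>k\<le>n - 3. p (Dc k 0) * p (Dy k)) p
      = (\<Sum>k\<le>n - 3. pd v (\<lambda>p. p (Dc k 0) * p (Dy k)) p)"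
    using assms by (intro pd_smooth_sum smooth_mult smooth_coord)
  also have "\<dots> = (\<Sum>k\<le>n - 3. (if v = Dc k 0 then p (Dy k) else 0) + (if v = Dy k then p (Dc k 0) else 0))"
    using assms by (intro sum.cong refl) (simp add: pd_smooth_mult smooth_coord pd_coord)
  finally show ?thesis by (simp add: pd_coord)
qed

text \<open>
  The equation involves the \<open>c\<^sub>k\<close> without derivatives, so the prolongation of the coefficient
  part of the field never appears.
\<close>

lemma prolonged_LF:
  assumes p: "p \<in> M"
  shows "prolonged n V (LF_equation n) p =
    prolong_coeff n (vf_x V) Dy (vf_y V) n p
    + (\<Sum>k\<le>n - 3. p (Dc k 0) * prolong_coeff n (vf_x V) Dy (vf_y V) k p)
    + (\<Sum>k\<le>n - 3. vf_c V k p * p (Dy k))"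
proof -
  let ?F = "\<lambda>k. prolong_coeff n (vf_x V) Dy (vf_y V) k p"
  have x: "pd Xvar (LF_equation n) p = 0"
    by (simp add: pd_LF[OF p])
  have y: "pd (Dy k) (LF_equation n) p = (if k = n then 1 else 0) + (if k \<le> n - 3 then p (Dc k 0) else 0)" for k
    by (simp add: pd_LF[OF p])
  have c: "pd (Dc i k) (LF_equation n) p = (if k = 0 then p (Dy i) else 0)" if "i \<le> n - 3" for i k
    using that by (cases "k = 0") (simp_all add: pd_LF[OF p])
  have "(\<Sum>k\<le>n. ?F k * pd (Dy k) (LF_equation n) p)
      = ?F n + (\<Sum>k\<le>n. if k \<le> n - 3 then ?F k * p (Dc k 0) else 0)"
    unfolding y by (simp add: distrib_left sum.distrib if_distrib[of "\<lambda>x. _ * x"] cong: if_cong)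
  also have "(\<Sum>k\<le>n. if k \<le> n - 3 then ?F k * p (Dc k 0) else 0) = (\<Sum>k\<le>n - 3. p (Dc k 0) * ?F k)"
    by (rule sum.mono_neutral_cong_right) auto
  finally have y_sum: "(\<Sum>k\<le>n. ?F k * pd (Dy k) (LF_equation n) p) = ?F n + (\<Sum>k\<le>n - 3. p (Dc k 0) * ?F k)" .
  have "(\<Sum>i\<le>n - 3. \<Sum>k\<le>n. prolong_coeff n (vf_x V) (Dc i) (vf_c V i) k p * pd (Dc i k) (LF_equation n) p)
      = (\<Sum>i\<le>n - 3. \<Sum>k\<le>n. if k = 0 then vf_c V i p * p (Dy i) else 0)"
    by (intro sum.cong refl) (simp add: c)
  then show ?thesis
    unfolding prolonged_def x y_sum by simp
qed

lemma exists_on_shell: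
  assumes "p \<in> M"
  shows "\<exists>t. p(Dy n := t) \<in> M \<and> LF_equation n (p(Dy n := t)) = 0"
proof -
  let ?t = "- (\<Sum>k\<le>n - 3. p (Dc k 0) * p (Dy k))"
  have "B (Dy n) = UNIV" using free_Dy[of "n - 1"] n_ge_3 by simp
  then have "p(Dy n := ?t) \<in> M" using assms upd_in by blast
  moreover have "(\<Sum>k\<le>n - 3. p (Dc k 0) * (p(Dy n := ?t)) (Dy k)) = (\<Sum>k\<le>n - 3. p (Dc k 0) * p (Dy k))"
    by (intro sum.cong refl) (use n_ge_3 in auto)
  then have "LF_equation n (p(Dy n := ?t)) = 0"
    by (simp add: LF_equation_def del: fun_upd_apply) simp
  ultimately show ?thesis by blast
qed

text \<open>
  The equation can be solved for \<open>y\<^sup>(\<^sup>n\<^sup>)\<close>; a function that does not see this coordinate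
  therefore vanishes everywhere once it vanishes on the solutions.
\<close>

lemma off_shell:
  assumes G: "jfun C G" "Dy n \<notin> C"
    and zero: "\<And>p. p \<in> M \<Longrightarrow> LF_equation n p = 0 \<Longrightarrow> G p = 0" and p: "p \<in> M"
  shows "G p = 0"
proof -
  obtain t where t: "p(Dy n := t) \<in> M" "LF_equation n (p(Dy n := t)) = 0"
    using exists_on_shell[OF p] by blast
  have "G p = G (p(Dy n := t))"
    by (rule jfun_eq[OF G(1) p t(1)]) (use G(2) in auto)
  with zero[OF t] show ?thesis by simp
qed

end

section \<open>Reduction to fields affine in the dependent variable\<close>

text \<open>
  The unknown components of a symmetry, together with the invariance condition in the form given
  by \<open>prolonged_LF\<close>.
\<close>

locale LF_symmetry = LF_box +
  fixes \<xi> \<eta> :: "jet \<Rightarrow> real" and \<phi> :: "nat \<Rightarrow> jet \<Rightarrow> real"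
  assumes base_\<xi>: "jfun (base_coords n) \<xi>"
    and base_\<eta>: "jfun (base_coords n) \<eta>"
    and base_\<phi>: "k \<le> n - 3 \<Longrightarrow> jfun (base_coords n) (\<phi> k)"
    and determining: "p \<in> M \<Longrightarrow> LF_equation n p = 0 \<Longrightarrow>
      prolong_coeff n \<xi> Dy \<eta> n p + (\<Sum>k\<le>n - 3. p (Dc k 0) * prolong_coeff n \<xi> Dy \<eta> k p)
        + (\<Sum>k\<le>n - 3. \<phi> k p * p (Dy k)) = 0"
begin

abbreviation D where "D \<equiv> total_deriv n"

abbreviation \<eta>_jet where "\<eta>_jet \<equiv> prolong_coeff n \<xi> Dy \<eta>"

lemma smooth_\<xi>: "jet_smooth_on M \<xi>" and smooth_\<eta>: "jet_smooth_on M \<eta>"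
  using base_\<xi> base_\<eta> jfun_smooth by blast+

lemma order_\<xi>: "jfun (order_le 0) \<xi>" and order_\<eta>: "jfun (order_le 0) \<eta>"
  using jfun_mono[OF _ base_coords_order] base_\<xi> base_\<eta> by blast+

lemma jfun_\<eta>_jet: "jfun (order_le k) (\<eta>_jet k)"
  by (rule jfun_prolong[OF order_\<xi> order_\<eta>])

lemma smooth_\<eta>_jet: "jet_smooth_on M (\<eta>_jet k)"
  by (rule jfun_smooth[OF jfun_\<eta>_jet])

lemma jfun_D\<xi>: "jfun (order_le 1) (D \<xi>)"
  using jfun_td_order[OF order_\<xi>] by simp

text \<open>
  Neither the equation nor any term of the invariance condition other than \<open>\<eta>\<^sub>n\<close> contains the coordinate
  \<open>v\<close>. Moving along \<open>v\<close> stays on the equation, and \<open>\<eta>\<^sub>n\<close> has to remain constant.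
\<close>

lemma on_shell_slope_zero:
  assumes v: "v \<notin> order_le (n - 3)" "v \<noteq> Dy n" and p: "p \<in> M" "LF_equation n p = 0"
  shows "pd v (\<eta>_jet n) p = 0"
proof -
  define c where "c = - ((\<Sum>k\<le>n - 3. p (Dc k 0) * \<eta>_jet k p) + (\<Sum>k\<le>n - 3. \<phi> k p * p (Dy k)))"
  have const: "\<eta>_jet n (p(v := t)) = c" if t: "t \<in> B v" for t
  proof -
    have q: "p(v := t) \<in> M" by (rule upd_in[OF p(1) t])
    have c_eq: "(p(v := t)) (Dc k 0) = p (Dc k 0)" for k using v(1) by auto
    have y_ne: "Dy k \<noteq> v" if "k \<le> n - 3" for k using v(1) that by auto
    have "LF_equation n (p(v := t)) = LF_equation n p"
      using v(2) unfolding LF_equation_def c_eq by (simp add: y_ne cong: sum.cong_simp)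
    then have "\<eta>_jet n (p(v := t)) + (\<Sum>k\<le>n - 3. (p(v := t)) (Dc k 0) * \<eta>_jet k (p(v := t)))
        + (\<Sum>k\<le>n - 3. \<phi> k (p(v := t)) * (p(v := t)) (Dy k)) = 0"
      using determining[OF q] p(2) by simp
    moreover have "\<eta>_jet k (p(v := t)) = \<eta>_jet k p" if "k \<le> n - 3" for k
      by (rule jfun_upd[OF jfun_\<eta>_jet[of k] p(1) t]) (use v(1) that in auto)
    moreover have "\<phi> k (p(v := t)) = \<phi> k p" if "k \<le> n - 3" for k
      by (rule jfun_upd[OF base_\<phi>[OF that] p(1) t]) (use v(1) in \<open>auto simp: base_coords_def\<close>)
    ultimately show ?thesis
      unfolding c_def c_eq by (simp add: y_ne cong: sum.cong_simp)
  qed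
  have "eventually (\<lambda>t. \<eta>_jet n (p(v := t)) = c) (nhds (p v))"
    using eventually_slice[OF p(1), of v] by eventually_elim (rule const)
  then have "deriv (\<lambda>t. \<eta>_jet n (p(v := t))) (p v) = deriv (\<lambda>t. c) (p v)"
    by (rule deriv_cong_ev) simp
  then show ?thesis by (simp add: pd_def)
qed

text \<open>
  The commutation rule shifts the top derivative of \<open>c\<^sub>i\<close> down one order at a time, until the first
  prolongation \<open>D \<eta> - y' D \<xi>\<close> is reached.
\<close>

lemma pd_Dc_\<eta>_jet:
  assumes i: "i \<le> n - 3" and p: "p \<in> M"
  shows "k < n \<Longrightarrow> pd (Dc i (Suc k)) (\<eta>_jet (Suc k)) p
    = pd (Dc i 0) \<eta> p - p (Dy 1) * pd (Dc i 0) \<xi> p"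
proof (induction k)
  case 0
  have "pd (Dc i (Suc 0)) (D \<eta>) p = pd (Dc i 0) \<eta> p" "pd (Dc i (Suc 0)) (D \<xi>) p = pd (Dc i 0) \<xi> p"
    using pd_Dc_Suc_td[OF smooth_\<eta> p i, of 0] pd_Dc_Suc_td[OF smooth_\<xi> p i, of 0]
      td_pd_absent[OF order_\<xi> _ p, of "Dc i (Suc 0)"] td_pd_absent[OF order_\<eta> _ p, of "Dc i (Suc 0)"]
    by simp_all
  then show ?case
    using pd_prolong_Suc[OF smooth_\<xi> smooth_\<eta> p, of "Dc i (Suc 0)" n 0] by simp
next
  case (Suc k)
  have "pd (Dc i (Suc (Suc k))) (D (\<eta>_jet (Suc k))) p = pd (Dc i (Suc k)) (\<eta>_jet (Suc k)) p"
    using pd_Dc_Suc_td[OF smooth_\<eta>_jet[of "Suc k"] p i, of "Suc k"] Suc.prems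
      td_pd_absent[OF jfun_\<eta>_jet[of "Suc k"] _ p, of "Dc i (Suc (Suc k))"]
    by (simp del: prolong_coeff.simps)
  moreover have "pd (Dc i (Suc (Suc k))) (D \<xi>) p = 0"
    by (rule pd_absent[OF jfun_D\<xi> _ p]) simp
  ultimately show ?case
    using pd_prolong_Suc[OF smooth_\<xi> smooth_\<eta> p, of "Dc i (Suc (Suc k))" n "Suc k"] Suc
    by (simp del: prolong_coeff.simps)
qed

text \<open>
  The slope is affine in the free coordinate \<open>y'\<close>, so both of its coefficients vanish.
\<close>

lemma pd_Dc_zero:
  assumes i: "i \<le> n - 3" and p: "p \<in> M"
  shows "pd (Dc i 0) \<xi> p = 0" and "pd (Dc i 0) \<eta> p = 0"
proof -
  \<comment> \<open>the slope in the top derivative of \<open>c\<^sub>i\<close>; it contains no jet coordinate above \<open>y'\<close>\<close>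
  let ?W = "\<lambda>p. pd (Dc i 0) \<eta> p - p (Dy 1) * pd (Dc i 0) \<xi> p"
  let ?C = "insert (Dy 1) (order_le 0)"
  have W: "jfun ?C ?W"
    by (intro jfun_diff jfun_mult jfun_coord jfun_pd jfun_mono[OF order_\<xi>] jfun_mono[OF order_\<eta>]) auto
  have "?W p = 0" if "p \<in> M" for p
  proof (rule off_shell[OF W])
    show "Dy n \<notin> ?C" using n_ge_3 by auto
  next
    fix p assume p: "p \<in> M" "LF_equation n p = 0"
    have "pd (Dc i n) (\<eta>_jet n) p = 0"
      by (rule on_shell_slope_zero[OF _ _ p]) (use n_ge_3 in auto)
    then show "?W p = 0"
      using pd_Dc_\<eta>_jet[OF i p(1), of "n - 1"] n_ge_3 by (simp del: prolong_coeff.simps)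
  qed (rule that)
  note W0 = this
  have upd: "p(Dy 1 := t) \<in> M" for t using upd_in[OF p] free_Dy[of 0] by simp
  have "pd (Dc i 0) \<xi> (p(Dy 1 := t)) = pd (Dc i 0) \<xi> p" "pd (Dc i 0) \<eta> (p(Dy 1 := t)) = pd (Dc i 0) \<eta> p" for t
    using jfun_upd[OF jfun_pd[OF order_\<xi>] p] jfun_upd[OF jfun_pd[OF order_\<eta>] p] free_Dy[of 0] by simp_all
  then show "pd (Dc i 0) \<eta> p = 0" "pd (Dc i 0) \<xi> p = 0"
    using W0[OF upd[of 0]] W0[OF upd[of 1]] by simp_all
qed

lemma jfun_xy: "jfun {Xvar, Dy 0} \<xi>" "jfun {Xvar, Dy 0} \<eta>"
proof -
  let ?S = "(\<lambda>i. Dc i 0) ` {..n - 3}"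
  have sub: "base_coords n - ?S \<subseteq> {Xvar, Dy 0}" by (auto simp: base_coords_def)
  have "jfun (base_coords n - ?S) \<xi>" "jfun (base_coords n - ?S) \<eta>"
    by (rule jfun_drop_set[OF _ base_\<xi>]; use pd_Dc_zero in auto)
      (rule jfun_drop_set[OF _ base_\<eta>]; use pd_Dc_zero in auto)
  then show "jfun {Xvar, Dy 0} \<xi>" "jfun {Xvar, Dy 0} \<eta>"
    using jfun_mono[OF _ sub] by blast+
qed

text \<open>
  The derivative of \<open>\<eta>\<^sub>j\<close> by \<open>y\<^sup>(\<^sup>j\<^sup>)\<close> for \<open>j \<ge> 1\<close> (\<open>pd_Dy_\<eta>_jet\<close>).
\<close>

definition leading_slope :: "nat \<Rightarrow> jet \<Rightarrow> real" where
  "leading_slope j = (\<lambda>p. pd (Dy 0) \<eta> p - p (Dy 1) * pd (Dy 0) \<xi> p - real j * D \<xi> p)"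

lemma jfun_leading_slope: "jfun (order_le 1) (leading_slope j)"
  unfolding leading_slope_def
  by (intro jfun_diff jfun_mult jfun_coord jfun_const jfun_pd jfun_D\<xi> jfun_mono[OF order_\<xi>] jfun_mono[OF order_\<eta>]) auto

lemma pd_Dy_1_D:
  assumes "jfun (order_le 0) F" "p \<in> M"
  shows "pd (Dy 1) (D F) p = pd (Dy 0) F p"
  using pd_Dy_Suc_td[OF jfun_smooth[OF assms(1)] assms(2), of 0 n]
    td_pd_absent[OF assms(1) _ assms(2), of "Dy 1" n] by simp

lemma pd_Dy_\<eta>_jet:
  assumes p: "p \<in> M"
  shows "k < n \<Longrightarrow> pd (Dy (Suc k)) (\<eta>_jet (Suc k)) p = leading_slope (Suc k) p"
proof (induction k)
  case 0
  show ?case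
    using pd_prolong_Suc[OF smooth_\<xi> smooth_\<eta> p, of "Dy (Suc 0)" n 0]
      pd_Dy_1_D[OF order_\<xi> p] pd_Dy_1_D[OF order_\<eta> p] by (simp add: leading_slope_def)
next
  case (Suc k)
  have "pd (Dy (Suc (Suc k))) (D (\<eta>_jet (Suc k))) p = leading_slope (Suc k) p"
    using pd_Dy_Suc_td[OF smooth_\<eta>_jet[of "Suc k"] p, of "Suc k" n] Suc
      td_pd_absent[OF jfun_\<eta>_jet[of "Suc k"] _ p, of "Dy (Suc (Suc k))" n]
    by (simp del: prolong_coeff.simps)
  moreover have "pd (Dy (Suc (Suc k))) (D \<xi>) p = 0"
    by (rule pd_absent[OF jfun_D\<xi> _ p]) simp
  ultimately show ?case
    using pd_prolong_Suc[OF smooth_\<xi> smooth_\<eta> p, of "Dy (Suc (Suc k))" n "Suc k"]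
    by (simp add: leading_slope_def algebra_simps del: prolong_coeff.simps)
qed

text \<open>
  The derivative of \<open>\<eta>\<^sub>k\<^sub>+\<^sub>2\<close> by \<open>y\<^sup>(\<^sup>k\<^sup>+\<^sup>1\<^sup>)\<close>. By the commutation rule, raising \<open>k\<close> by one adds the total
  derivative of the next leading slope. The term with \<open>y''\<close> arises only at \<open>k = 0\<close>, where \<open>D \<xi>\<close>
  itself depends on the coordinate \<open>y'\<close>.
\<close>

lemma pd_Dy_\<eta>_jet_Suc:
  assumes p: "p \<in> M"
  shows "Suc k < n \<Longrightarrow> pd (Dy (Suc k)) (\<eta>_jet (Suc (Suc k))) p
    = pd (Dy 0) (\<eta>_jet 1) p - p (Dy 2) * pd (Dy 0) \<xi> p + (\<Sum>j = 1..Suc k. D (leading_slope j) p)"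
proof (induction k)
  case 0
  have "eqM (pd (Dy 1) (\<eta>_jet 1)) (leading_slope 1)"
    using pd_Dy_\<eta>_jet[of _ 0] n_ge_3 by (simp add: eqM_def)
  then have "pd (Dy 1) (D (\<eta>_jet 1)) p = D (leading_slope 1) p + pd (Dy 0) (\<eta>_jet 1) p"
    using pd_Dy_Suc_td[OF smooth_\<eta>_jet[of 1] p, of 0 n] td_cong'[OF _ p] by simp
  then show ?case
    using pd_prolong_Suc[OF smooth_\<xi> smooth_\<eta> p, of "Dy 1" n 1] pd_Dy_1_D[OF order_\<xi> p]
    by (simp del: prolong_coeff.simps add: numeral_2_eq_2)
next
  case (Suc k)
  have "eqM (pd (Dy (Suc (Suc k))) (\<eta>_jet (Suc (Suc k)))) (leading_slope (Suc (Suc k)))"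
    using pd_Dy_\<eta>_jet[of _ "Suc k"] Suc.prems by (simp add: eqM_def del: prolong_coeff.simps)
  then have "pd (Dy (Suc (Suc k))) (D (\<eta>_jet (Suc (Suc k)))) p
      = D (leading_slope (Suc (Suc k))) p + pd (Dy (Suc k)) (\<eta>_jet (Suc (Suc k))) p"
    using pd_Dy_Suc_td[OF smooth_\<eta>_jet[of "Suc (Suc k)"] p, of "Suc k" n] td_cong'[OF _ p] Suc.prems
    by (simp del: prolong_coeff.simps)
  moreover have "pd (Dy (Suc (Suc k))) (D \<xi>) p = 0"
    by (rule pd_absent[OF jfun_D\<xi> _ p]) simp
  ultimately show ?case
    using pd_prolong_Suc[OF smooth_\<xi> smooth_\<eta> p, of "Dy (Suc (Suc k))" n "Suc (Suc k)"] Suc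
    by (simp del: prolong_coeff.simps)
qed

text \<open>
  The derivative of \<open>\<eta>\<^sub>n\<close> by \<open>y\<^sup>(\<^sup>n\<^sup>-\<^sup>1\<^sup>)\<close>. It is a function of order at most 2, hence free of \<open>y\<^sup>(\<^sup>n\<^sup>)\<close>.
\<close>

definition subleading_slope :: "jet \<Rightarrow> real" where
  "subleading_slope = (\<lambda>p. pd (Dy 0) (\<eta>_jet 1) p - p (Dy 2) * pd (Dy 0) \<xi> p + (\<Sum>j = 1..n - 1. D (leading_slope j) p))"

lemma subleading_slope_zero:
  assumes p: "p \<in> M"
  shows "subleading_slope p = 0"
proof (rule off_shell[OF _ _ _ p])
  have DA: "jfun (order_le 2) (D (leading_slope j))" for j
    using jfun_td_order[OF jfun_leading_slope] by (simp add: numeral_2_eq_2)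
  have "order_le 1 \<subseteq> order_le 2" "order_le 0 \<subseteq> order_le 2" by auto
  then show "jfun (order_le 2) subleading_slope"
    unfolding subleading_slope_def
    by (intro jfun_add jfun_diff jfun_mult jfun_coord jfun_sum jfun_pd DA
        jfun_mono[OF order_\<xi>] jfun_mono[OF jfun_\<eta>_jet]) auto
  show "Dy n \<notin> order_le 2" using n_ge_3 by auto
  fix p assume p: "p \<in> M" "LF_equation n p = 0"
  have "pd (Dy (n - 1)) (\<eta>_jet n) p = 0"
    by (rule on_shell_slope_zero[OF _ _ p]) (use n_ge_3 in auto)
  moreover have m: "Suc (Suc (n - 2)) = n" "Suc (n - 2) = n - 1" using n_ge_3 by auto
  ultimately show "subleading_slope p = 0"
    using pd_Dy_\<eta>_jet_Suc[OF p(1), of "n - 2", unfolded m] n_ge_3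
    by (simp add: subleading_slope_def del: prolong_coeff.simps)
qed

lemma pd_subleading_slope:
  assumes p: "p \<in> M"
  shows "pd v (pd (Dy 0) (\<eta>_jet 1)) p - (if v = Dy 2 then pd (Dy 0) \<xi> p else 0)
    - p (Dy 2) * pd v (pd (Dy 0) \<xi>) p + (\<Sum>j = 1..n - 1. pd v (D (leading_slope j)) p) = 0"
proof -
  note [simp] = smooth_pd smooth_\<eta>_jet smooth_\<xi> smooth_coord smooth_mult smooth_diff smooth_sum
    smooth_td jfun_smooth[OF jfun_leading_slope]
  have "pd v subleading_slope p = pd v (pd (Dy 0) (\<eta>_jet 1)) p - (if v = Dy 2 then pd (Dy 0) \<xi> p else 0)
    - p (Dy 2) * pd v (pd (Dy 0) \<xi>) p + (\<Sum>j = 1..n - 1. pd v (D (leading_slope j)) p)"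
    unfolding subleading_slope_def using p
    by (simp add: pd_smooth_add pd_smooth_diff pd_smooth_mult pd_smooth_sum pd_coord
        del: prolong_coeff.simps One_nat_def)
  moreover have "pd v subleading_slope p = pd v (\<lambda>p. 0) p"
    by (rule pd_cong[OF _ p]) (simp add: eqM_def subleading_slope_zero)
  ultimately show ?thesis by (simp add: pd_const)
qed

text \<open>
  Differentiating the subleading slope by \<open>y''\<close> leaves \<open>\<xi>\<^sub>y\<close> with a negative numerical factor. For
  \<open>n = 3\<close> this is the second derivative of a quadratic term in \<open>y''\<close>, for larger \<open>n\<close> the coefficient of
  \<open>y'' y\<^sup>(\<^sup>n\<^sup>-\<^sup>1\<^sup>)\<close>; the computation is the same.
\<close>

lemma \<xi>_y_zero:
  assumes p: "p \<in> M"
  shows "pd (Dy 0) \<xi> p = 0"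
proof -
  have A: "pd (Dy 1) (leading_slope j) p = - (1 + real j) * pd (Dy 0) \<xi> p" for j
  proof -
    note [simp] = smooth_pd smooth_\<eta> smooth_\<xi> smooth_coord smooth_mult smooth_diff smooth_const smooth_td
    have "pd (Dy 1) (pd (Dy 0) \<xi>) p = 0" "pd (Dy 1) (pd (Dy 0) \<eta>) p = 0"
      using pd_absent[OF jfun_pd[OF order_\<xi>] _ p] pd_absent[OF jfun_pd[OF order_\<eta>] _ p] by simp_all
    then have "pd (Dy 1) (leading_slope j) p = - pd (Dy 0) \<xi> p - real j * pd (Dy 0) \<xi> p"
      unfolding leading_slope_def using p pd_Dy_1_D[OF order_\<xi> p]
      by (simp add: pd_smooth_diff pd_smooth_mult pd_coord pd_const)
    then show ?thesis by (simp add: algebra_simps)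
  qed
  have DA: "pd (Dy 2) (D (leading_slope j)) p = - (1 + real j) * pd (Dy 0) \<xi> p" for j
    using pd_Dy_Suc_td[OF jfun_smooth[OF jfun_leading_slope] p, of 1 n j] n_ge_3
      td_pd_absent[OF jfun_leading_slope _ p, of "Dy 2" n j] A by (simp add: numeral_2_eq_2)
  have 1: "pd (Dy 2) (pd (Dy 0) (\<eta>_jet 1)) p = 0"
    by (rule pd_absent[OF jfun_pd[OF jfun_\<eta>_jet] _ p]) simp
  have 2: "pd (Dy 2) (pd (Dy 0) \<xi>) p = 0"
    by (rule pd_absent[OF jfun_pd[OF order_\<xi>] _ p]) simp
  have "(1 + (\<Sum>j = 1..n - 1. 1 + real j)) * pd (Dy 0) \<xi> p = 0"
    using pd_subleading_slope[OF p, of "Dy 2"] unfolding 1 2 DA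
    by (simp add: algebra_simps sum_distrib_left sum_distrib_right sum_negf sum_subtractf sum.distrib)
  moreover have "1 + (\<Sum>j = 1..n - 1. 1 + real j) > 0"
    by (intro add_pos_nonneg sum_nonneg) auto
  ultimately show ?thesis by simp
qed

lemma \<xi>_x: "jfun {Xvar} \<xi>"
  using jfun_drop[OF jfun_xy(1) \<xi>_y_zero] by (rule jfun_mono) auto

lemma D\<xi>: "p \<in> M \<Longrightarrow> D \<xi> p = pd Xvar \<xi> p"
  by (rule td_x[OF \<xi>_x])

text \<open>
  With \<open>\<xi>\<^sub>y = 0\<close>, each of the \<open>n\<close> terms of the subleading slope contributes one \<open>\<eta>\<^sub>y\<^sub>y\<close> when
  differentiated by \<open>y'\<close>.
\<close>

lemma \<eta>_yy_zero:
  assumes p: "p \<in> M"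
  shows "pd (Dy 0) (pd (Dy 0) \<eta>) p = 0"
proof -
  have \<xi>'_x: "jfun {Xvar} (pd Xvar \<xi>)" by (rule jfun_pd[OF \<xi>_x])
  have A_eq: "eqM (leading_slope j) (\<lambda>p. pd (Dy 0) \<eta> p - real j * pd Xvar \<xi> p)" for j
    by (simp add: eqM_def leading_slope_def \<xi>_y_zero D\<xi>)
  have A': "jfun (order_le 0) (\<lambda>p. pd (Dy 0) \<eta> p - real j * pd Xvar \<xi> p)" for j
    by (intro jfun_diff jfun_mult jfun_const jfun_pd order_\<eta> order_\<xi>)
  have pd_A: "pd (Dy 0) (leading_slope j) p = pd (Dy 0) (pd (Dy 0) \<eta>) p" for j
  proof -
    have "pd (Dy 0) (leading_slope j) p = pd (Dy 0) (\<lambda>p. pd (Dy 0) \<eta> p - real j * pd Xvar \<xi> p) p"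
      by (rule pd_cong[OF A_eq p])
    also have "\<dots> = pd (Dy 0) (pd (Dy 0) \<eta>) p - real j * pd (Dy 0) (pd Xvar \<xi>) p"
      using p by (simp add: pd_smooth_diff pd_smooth_mult smooth_pd smooth_\<eta> smooth_\<xi> smooth_mult
          smooth_const pd_const)
    finally show ?thesis using pd_absent[OF \<xi>'_x _ p] by simp
  qed
  have DA: "pd (Dy 1) (D (leading_slope j)) p = pd (Dy 0) (pd (Dy 0) \<eta>) p" for j
    using pd_Dy_1_D[OF jfun_cong[OF A' eqM_sym[OF A_eq]] p] pd_A by simp
  have "pd (Dy 1) (pd (Dy 0) (\<eta>_jet 1)) p = pd (Dy 0) (pd (Dy 1) (\<eta>_jet 1)) p"
    by (rule pd_commute[OF smooth_\<eta>_jet p])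
  also have "\<dots> = pd (Dy 0) (leading_slope 1) p"
    by (rule pd_cong[OF _ p]) (use pd_Dy_\<eta>_jet[of _ 0] n_ge_3 in \<open>simp add: eqM_def\<close>)
  finally have 1: "pd (Dy 1) (pd (Dy 0) (\<eta>_jet 1)) p = pd (Dy 0) (pd (Dy 0) \<eta>) p"
    by (simp add: pd_A)
  have 2: "pd (Dy 1) (pd (Dy 0) \<xi>) p = 0"
    by (rule pd_absent[OF jfun_pd[OF \<xi>_x] _ p]) simp
  show ?thesis
    using pd_subleading_slope[OF p, of "Dy 1"] n_ge_3 unfolding 1 2 DA by (simp add: of_nat_diff algebra_simps)
qed

end

section \<open>The remaining determining equations\<close>

lemma real_choose_two: "real (n choose 2) = real n * (real n - 1) / 2"
  by (cases n) (simp_all add: choose_two of_nat_div algebra_simps real_of_nat_div)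

lemma real_choose_three: "real (n choose 3) = real n * (real n - 1) * (real n - 2) / 6"
proof (cases n)
  case (Suc m)
  have "3 * (n choose 3) = n * (m choose 2)"
    using times_binomial_minus1_eq[of 3 n] Suc by simp
  then have "3 * real (n choose 3) = real n * real (m choose 2)"
    by (metis of_nat_mult of_nat_numeral)
  then show ?thesis by (simp add: real_choose_two Suc field_simps)
qed simp

context jet_box
begin

lemma jfun_minus: "jfun C F \<Longrightarrow> jfun C (\<lambda>p. - F p)"
  using jfun_diff[OF jfun_const[of C 0]] by simp

lemma jfun_empty_const:
  assumes "jfun {} F"
  shows "\<exists>c. \<forall>p\<in>M. F p = c"
proof -
  obtain q where "q \<in> M" using nonempty by blast
  then have "\<forall>p\<in>M. F p = F q" using jfun_eq[OF assms] by blast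
  then show ?thesis by blast
qed

lemma x_derivative_zero:
  assumes "jfun {Xvar} F" "\<And>p. p \<in> M \<Longrightarrow> pd Xvar F p = 0"
  shows "\<exists>c. \<forall>p\<in>M. F p = c"
  using jfun_empty_const[of F] jfun_drop[OF assms] by simp

lemma jfun_x_funpow: "jfun {Xvar} F \<Longrightarrow> jfun {Xvar} ((pd Xvar ^^ j) F)"
  by (induction j) (simp_all add: jfun_pd)

text \<open>
  Fixing all other coordinates turns a jet function of \<open>x\<close> alone into a function of one real variable,
  whose iterated derivatives are the restrictions of the iterated partial derivatives.
\<close>

lemma jfun_x_function:
  assumes F: "jfun {Xvar} F"
  shows "\<exists>h. smooth_fun_on (B Xvar) h \<and> (\<forall>p\<in>M. F p = h (p Xvar))"
proof -
  obtain q where q: "q \<in> M" using nonempty by blast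
  define h where "h = (\<lambda>x. F (q(Xvar := x)))"
  have deriv: "deriv (\<lambda>x. H (q(Xvar := x))) = (\<lambda>x. pd Xvar H (q(Xvar := x)))" for H
    by (simp add: pd_def fun_eq_iff)
  have iter: "(deriv ^^ j) h = (\<lambda>x. (pd Xvar ^^ j) F (q(Xvar := x)))" for j
    by (induction j) (simp_all add: h_def deriv del: fun_upd_apply)
  have "smooth_fun_on (B Xvar) h"
    unfolding smooth_fun_on_def iter
  proof (intro allI ballI)
    fix j x assume "x \<in> B Xvar"
    then have "q(Xvar := x) \<in> M" by (rule upd_in[OF q])
    then show "(\<lambda>x. (pd Xvar ^^ j) F (q(Xvar := x))) differentiable at x"
      using pdiff_DERIV[OF smooth_pdiff[OF jfun_smooth[OF jfun_x_funpow[OF F]]],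
          of "q(Xvar := x)" j Xvar] real_differentiable_def by fastforce
  qed
  moreover have "F p = h (p Xvar)" if p: "p \<in> M" for p
    unfolding h_def by (rule jfun_eq[OF F p upd_in[OF q coord_in[OF p]]]) simp
  ultimately show ?thesis by blast
qed

end

context LF_symmetry
begin

definition \<eta>_y :: "jet \<Rightarrow> real" where "\<eta>_y = pd (Dy 0) \<eta>"

lemma jfun_\<eta>_y: "jfun {Xvar} \<eta>_y"
  unfolding \<eta>_y_def
  by (rule jfun_mono[OF jfun_drop[OF jfun_pd[OF jfun_xy(2)] \<eta>_yy_zero]]) auto

abbreviation dx :: "nat \<Rightarrow> (jet \<Rightarrow> real) \<Rightarrow> jet \<Rightarrow> real" where
  "dx j F \<equiv> (pd Xvar ^^ j) F"

lemma D_combination: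
  assumes "jfun {Xvar} F" "jfun {Xvar} H" "p \<in> M"
  shows "D (\<lambda>p. a * F p - b * H p) p = a * pd Xvar F p - b * pd Xvar H p"
  using assms td_x[OF assms(1,3)] td_x[OF assms(2,3)]
  by (simp add: td_diff td_mult td_const smooth_mult smooth_const jfun_smooth)

lemma pd_Dy_D\<xi>:
  assumes p: "p \<in> M"
  shows "pd (Dy k) (D \<xi>) p = 0"
proof -
  have "pd (Dy k) (D \<xi>) p = pd (Dy k) (pd Xvar \<xi>) p"
    by (rule pd_cong[OF _ p]) (simp add: eqM_def D\<xi>)
  also have "\<dots> = 0" by (rule pd_absent[OF jfun_pd[OF \<xi>_x] _ p]) simp
  finally show ?thesis .
qed

text \<open>
  Now \<open>\<eta> = y \<eta>\<^sub>y + h\<close> with \<open>\<eta>\<^sub>y\<close> and \<open>\<xi>\<close> functions of \<open>x\<close>, and \<open>\<eta>\<^sub>K\<close> is affine in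
  \<open>y, y', \<dots>, y\<^sup>(\<^sup>K\<^sup>)\<close>. The commutation rule turns into the recursion of Pascal's triangle for the
  coefficients.
\<close>

lemma \<eta>_jet_coefficients:
  "p \<in> M \<Longrightarrow> K \<le> n \<Longrightarrow> k \<le> K \<Longrightarrow> pd (Dy k) (\<eta>_jet K) p
    = real (K choose (K - k)) * dx (K - k) \<eta>_y p - real (K choose Suc (K - k)) * dx (Suc (K - k)) \<xi> p"
proof (induction K arbitrary: k p)
  case 0
  then show ?case by (simp add: \<eta>_y_def)
next
  case (Suc K)
  note p = Suc.prems(1)
  let ?f = "\<lambda>k p. real (K choose (K - k)) * dx (K - k) \<eta>_y p - real (K choose Suc (K - k)) * dx (Suc (K - k)) \<xi> p"
  have IH: "eqM (pd (Dy k) (\<eta>_jet K)) (?f k)" if "k \<le> K" for k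
    using Suc.IH[of _ k] Suc.prems that by (simp add: eqM_def del: funpow.simps)
  have D_pd: "D (pd (Dy k) (\<eta>_jet K)) p = real (K choose (K - k)) * dx (Suc (K - k)) \<eta>_y p
      - real (K choose Suc (K - k)) * dx (Suc (Suc (K - k))) \<xi> p" if "k \<le> K" for k
    using td_cong'[OF IH[OF that] p] D_combination[OF jfun_x_funpow[OF jfun_\<eta>_y, of "K - k"]
        jfun_x_funpow[OF \<xi>_x, of "Suc (K - k)"] p]
    by simp
  have step: "pd (Dy k) (\<eta>_jet (Suc K)) p
      = pd (Dy k) (D (\<eta>_jet K)) p - (if k = Suc K then pd Xvar \<xi> p else 0)"
    using pd_prolong_Suc[OF smooth_\<xi> smooth_\<eta> p, of "Dy k" n K] pd_Dy_D\<xi>[OF p] D\<xi>[OF p]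
    by (simp del: prolong_coeff.simps)
  show ?case
  proof (cases k)
    case 0
    then show ?thesis
      using step pd_Dy_0_td[OF smooth_\<eta>_jet p, of n K] D_pd[of 0]
      by (simp del: prolong_coeff.simps funpow.simps)
  next
    case (Suc l)
    have pd_D: "pd (Dy k) (D (\<eta>_jet K)) p = D (pd (Dy k) (\<eta>_jet K)) p + ?f l p"
      using pd_Dy_Suc_td[OF smooth_\<eta>_jet p, of l n K] Suc Suc.prems eqM_D[OF IH[of l] p]
      by (simp del: prolong_coeff.simps funpow.simps)
    show ?thesis
    proof (cases "k \<le> K")
      case True
      then have "K - l = Suc (K - k)" "Suc K - k = Suc (K - k)" "k \<noteq> Suc K"
        using Suc by auto
      then show ?thesis
        using step pd_D D_pd[OF True]
        by (simp add: algebra_simps del: prolong_coeff.simps funpow.simps)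
    next
      case False
      then have k: "k = Suc K" "l = K" using Suc Suc.prems by auto
      have "D (pd (Dy k) (\<eta>_jet K)) p = 0"
        by (rule td_pd_absent[OF jfun_\<eta>_jet _ p]) (use k in simp)
      then show ?thesis
        using step pd_D k by (simp add: algebra_simps del: prolong_coeff.simps)
    qed
  qed
qed

lemma coefficient_zero:
  assumes "p \<in> M" "a \<in> {1, 2}"
  shows "real (n choose a) * dx a \<eta>_y p = real (n choose Suc a) * dx (Suc a) \<xi> p"
proof -
  let ?G = "\<lambda>p. real (n choose a) * dx a \<eta>_y p - real (n choose Suc a) * dx (Suc a) \<xi> p"
  have "?G p = 0"
  proof (rule off_shell[OF _ _ _ assms(1)])
    show "jfun {Xvar} ?G"
      by (intro jfun_diff jfun_mult jfun_const jfun_x_funpow jfun_\<eta>_y \<xi>_x)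
    fix p assume p: "p \<in> M" "LF_equation n p = 0"
    have "pd (Dy (n - a)) (\<eta>_jet n) p = 0"
      by (rule on_shell_slope_zero[OF _ _ p]) (use assms n_ge_3 in auto)
    moreover have "n - (n - a) = a" using assms n_ge_3 by auto
    ultimately show "?G p = 0"
      using \<eta>_jet_coefficients[OF p(1), of n "n - a"] by simp
  qed simp
  then show ?thesis by simp
qed

lemma \<eta>_y_derivative: "p \<in> M \<Longrightarrow> pd Xvar \<eta>_y p = (real n - 1) / 2 * pd Xvar (pd Xvar \<xi>) p"
proof -
  assume p: "p \<in> M"
  have "real n * pd Xvar \<eta>_y p = real n * ((real n - 1) / 2 * pd Xvar (pd Xvar \<xi>) p)"
    using coefficient_zero[OF p, of 1] real_choose_two[of n] by (simp add: numeral_2_eq_2)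
  then show ?thesis using n_ge_3 by simp
qed

text \<open>
  Differentiating the first relation between \<open>\<eta>\<^sub>y\<close> and \<open>\<xi>\<close> and inserting it into the second leaves
  \<open>n (n - 1) (n + 1) / 12 \<xi>''' = 0\<close>.
\<close>

lemma \<xi>_xxx_zero:
  assumes p: "p \<in> M"
  shows "pd Xvar (pd Xvar (pd Xvar \<xi>)) p = 0"
proof -
  let ?z = "pd Xvar (pd Xvar (pd Xvar \<xi>)) p"
  have smooth: "jet_smooth_on M (pd Xvar (pd Xvar \<xi>))" by (intro smooth_pd smooth_\<xi>)
  have "pd Xvar (pd Xvar \<eta>_y) p = pd Xvar (\<lambda>p. (real n - 1) / 2 * pd Xvar (pd Xvar \<xi>) p) p"
    by (rule pd_cong[OF _ p]) (simp add: eqM_def \<eta>_y_derivative)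
  also have "\<dots> = (real n - 1) / 2 * ?z"
    unfolding pd_smooth_mult[OF smooth_const smooth p] by (simp add: pd_const)
  finally have \<eta>_yxx: "pd Xvar (pd Xvar \<eta>_y) p = (real n - 1) / 2 * ?z" .
  have "real (n choose 2) * pd Xvar (pd Xvar \<eta>_y) p = real (n choose 3) * ?z"
    using coefficient_zero[OF p, of 2] by (simp add: numeral_2_eq_2 numeral_3_eq_3)
  then have "real (n choose 2) * ((real n - 1) / 2 * ?z) = real (n choose 3) * ?z"
    unfolding \<eta>_yxx .
  then have "real n * (real n - 1) * (real n + 1) / 12 * ?z = 0"
    unfolding real_choose_two real_choose_three by (simp add: field_simps)
  then show ?thesis using n_ge_3 by simp
qed

lemma explicit_\<xi>_\<eta>:
  "\<exists>a0 a1 a2 k1 h. smooth_fun_on (B Xvar) h \<and> (\<forall>p\<in>M.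
    \<xi> p = a2 * (p Xvar)\<^sup>2 + a1 * p Xvar + a0 \<and>
    \<eta> p = p (Dy 0) * (k1 + (real n - 1) / 2 * (2 * a2 * p Xvar + a1)) + h (p Xvar))"
proof -
  let ?x = "\<lambda>p::jet. p Xvar"
  note [simp] = pd_smooth_diff pd_smooth_mult smooth_mult smooth_diff smooth_const smooth_coord
    smooth_pd smooth_\<xi> smooth_\<eta> pd_const pd_coord jfun_smooth[OF jfun_\<eta>_y]
  have \<xi>'': "jfun {Xvar} (pd Xvar (pd Xvar \<xi>))" by (intro jfun_pd \<xi>_x)
  obtain b where b: "\<And>p. p \<in> M \<Longrightarrow> pd Xvar (pd Xvar \<xi>) p = b"
    using x_derivative_zero[OF \<xi>'' \<xi>_xxx_zero] by blast
  \<comment> \<open>integrate \<open>\<xi>''' = 0\<close> one step at a time: each time the next constant is the difference of two functions with equal derivative\<close>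
  define a2 where "a2 = b / 2"
  have "jfun {Xvar} (\<lambda>p. pd Xvar \<xi> p - 2 * a2 * ?x p)"
    by (intro jfun_diff jfun_mult jfun_const jfun_pd jfun_coord \<xi>_x) simp
  then have "\<exists>c. \<forall>p\<in>M. pd Xvar \<xi> p - 2 * a2 * ?x p = c"
    by (rule x_derivative_zero) (simp add: b a2_def)
  then obtain a1 where a1: "\<And>p. p \<in> M \<Longrightarrow> pd Xvar \<xi> p - 2 * a2 * ?x p = a1" by blast
  have "jfun {Xvar} (\<lambda>p. \<xi> p - a2 * (?x p * ?x p) - a1 * ?x p)"
    by (intro jfun_diff jfun_mult jfun_const jfun_coord \<xi>_x) simp_all
  then have "\<exists>c. \<forall>p\<in>M. \<xi> p - a2 * (?x p * ?x p) - a1 * ?x p = c"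
  proof (rule x_derivative_zero)
    fix p assume p: "p \<in> M"
    have "pd Xvar (\<lambda>p. \<xi> p - a2 * (?x p * ?x p) - a1 * ?x p) p = pd Xvar \<xi> p - a2 * (?x p + ?x p) - a1"
      using p by simp
    then show "pd Xvar (\<lambda>p. \<xi> p - a2 * (?x p * ?x p) - a1 * ?x p) p = 0"
      using a1[OF p] by simp
  qed
  then obtain a0 where a0: "\<And>p. p \<in> M \<Longrightarrow> \<xi> p - a2 * (?x p * ?x p) - a1 * ?x p = a0" by blast
  define r where "r = (real n - 1) / 2"
  have "jfun {Xvar} (\<lambda>p. \<eta>_y p - r * pd Xvar \<xi> p)"
    by (intro jfun_diff jfun_mult jfun_const jfun_pd jfun_\<eta>_y \<xi>_x)
  then have "\<exists>c. \<forall>p\<in>M. \<eta>_y p - r * pd Xvar \<xi> p = c"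
    by (rule x_derivative_zero) (simp add: \<eta>_y_derivative r_def[symmetric])
  then obtain k1 where k1: "\<And>p. p \<in> M \<Longrightarrow> \<eta>_y p - r * pd Xvar \<xi> p = k1" by blast
  have "jfun ({Xvar, Dy 0} - {Dy 0}) (\<lambda>p. \<eta> p - p (Dy 0) * \<eta>_y p)"
  proof (rule jfun_drop)
    show "jfun {Xvar, Dy 0} (\<lambda>p. \<eta> p - p (Dy 0) * \<eta>_y p)"
      by (intro jfun_diff jfun_mult jfun_coord jfun_xy jfun_mono[OF jfun_\<eta>_y]) auto
    show "pd (Dy 0) (\<lambda>p. \<eta> p - p (Dy 0) * \<eta>_y p) p = 0" if "p \<in> M" for p
      using that \<eta>_yy_zero[OF that] by (simp add: \<eta>_y_def)
  qed
  then have "jfun {Xvar} (\<lambda>p. \<eta> p - p (Dy 0) * \<eta>_y p)"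
    by (rule jfun_mono) auto
  then obtain h where h: "smooth_fun_on (B Xvar) h"
    "\<And>p. p \<in> M \<Longrightarrow> \<eta> p - p (Dy 0) * \<eta>_y p = h (p Xvar)"
    using jfun_x_function by meson
  show ?thesis
  proof (intro exI conjI ballI)
    show "smooth_fun_on (B Xvar) h" by (rule h(1))
    fix p assume p: "p \<in> M"
    show "\<xi> p = a2 * (p Xvar)\<^sup>2 + a1 * p Xvar + a0"
      using a0[OF p] by (simp add: power2_eq_square)
    have "\<eta>_y p = k1 + (real n - 1) / 2 * (2 * a2 * p Xvar + a1)"
      using k1[OF p] a1[OF p] unfolding r_def[symmetric] by (simp add: algebra_simps)
    then show "\<eta> p = p (Dy 0) * (k1 + (real n - 1) / 2 * (2 * a2 * p Xvar + a1)) + h (p Xvar)"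
      using h(2)[OF p] by simp
  qed
qed

end

section \<open>The explicit fields are symmetries, and the only ones\<close>

context LF_box
begin

lemma base_function_iff: "base_function n M F \<longleftrightarrow> jfun (base_coords n) F"
  by (simp add: base_function_def jfun_def)

lemma prolong_cong:
  assumes "eqM \<xi> \<xi>'" "eqM \<eta> \<eta>'"
  shows "eqM (prolong_coeff n \<xi> u \<eta> k) (prolong_coeff n \<xi>' u \<eta>' k)"
proof (induction k)
  case (Suc k)
  show ?case
    using eqM_D[OF td_cong[OF Suc]] eqM_D[OF td_cong[OF assms(1)]] by (simp add: eqM_def)
qed (simp add: assms(2))

lemma GS_cong:
  assumes W: "GS_generator n M W" and eq: "vfield_eq_on n M V W"
  shows "GS_generator n M V"
proof -
  have x: "eqM (vf_x W) (vf_x V)" and y: "eqM (vf_y W) (vf_y V)"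
    and c: "\<And>k. k \<le> n - 3 \<Longrightarrow> eqM (vf_c W k) (vf_c V k)"
    using eq by (auto simp: vfield_eq_on_def eqM_def)
  have "vfield_on n M V"
    using W jfun_cong[OF _ x] jfun_cong[OF _ y] jfun_cong[OF _ c]
    by (simp add: GS_generator_def vfield_on_def base_function_iff)
  moreover have "prolonged n V (LF_equation n) p = prolonged n W (LF_equation n) p" if p: "p \<in> M" for p
    unfolding prolonged_LF[OF p]
    using eqM_D[OF prolong_cong[OF x y] p] eqM_D[OF c p] by (simp cong: sum.cong_simp)
  ultimately show ?thesis
    using W by (simp add: GS_generator_def)
qed

lemma jfun_coeff_c: "k \<le> n \<Longrightarrow> jfun (base_coords n) (coeff_c n k)"
proof -
  assume "k \<le> n"
  then consider "k = n" | "k \<noteq> n" "k = n - 1 \<or> k = n - 2" | "k \<noteq> n" "\<not> (k = n - 1 \<or> k = n - 2)" "k \<le> n - 3"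
    by linarith
  then show ?thesis
  proof cases
    case 1
    then have "coeff_c n k = (\<lambda>p. 1)" by (simp add: fun_eq_iff coeff_c_def)
    then show ?thesis by (simp add: jfun_const)
  next
    case 2
    then have "coeff_c n k = (\<lambda>p. 0)" by (simp add: fun_eq_iff coeff_c_def)
    then show ?thesis by (simp add: jfun_const)
  next
    case 3
    then have "coeff_c n k = (\<lambda>p. p (Dc k 0))" by (simp add: fun_eq_iff coeff_c_def)
    with 3 show ?thesis by (simp add: jfun_coord base_coords_def)
  qed
qed

lemma coeff_c_low: "k \<le> n - 3 \<Longrightarrow> coeff_c n k p = p (Dc k 0)"
  using n_ge_3 by (auto simp: coeff_c_def)

lemma coeff_c_high: "coeff_c n (n - 2) p = 0" "coeff_c n (n - 1) p = 0" "coeff_c n n p = 1"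
  using n_ge_3 by (auto simp: coeff_c_def)

context
  fixes a0 a1 a2 k1 :: real and h :: "real \<Rightarrow> real"
  assumes h: "smooth_fun_on (B Xvar) h"
begin

abbreviation X where "X \<equiv> Xn n a0 a1 a2 k1 h"

abbreviation h_jet :: "nat \<Rightarrow> jet \<Rightarrow> real" where "h_jet j p \<equiv> (deriv ^^ j) h (p Xvar)"

lemma vfield_on_Xn: "vfield_on n M X"
proof -
  have x: "jfun (base_coords n) (\<lambda>p. p Xvar)" and y: "jfun (base_coords n) (\<lambda>p. p (Dy 0))"
    by (rule jfun_coord; simp add: base_coords_def)+
  have hj: "jfun (base_coords n) (h_jet j)" for j
    by (rule jfun_fun_coord[OF _ h]) (simp add: base_coords_def)
  have inv: "jfun (base_coords n) (\<lambda>p. inverse (p (Dy 0)))"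
    by (rule jfunI[OF smooth_inverse_coord[OF Dy_0_nonzero]]) (simp add: base_coords_def)
  have h0: "jfun (base_coords n) (\<lambda>p. h (p Xvar))" using hj[of 0] by simp
  have "jfun (base_coords n) (vf_x X)"
    unfolding Xn_def vfield.simps power2_eq_square by (intro jfun_add jfun_mult jfun_const x)
  moreover have "jfun (base_coords n) (vf_y X)"
    unfolding Xn_def vfield.simps by (intro jfun_add jfun_mult jfun_const x y h0)
  moreover have "jfun (base_coords n) (vf_c X k)" if "k \<le> n - 3" for k
  proof -
    have c: "jfun (base_coords n) (coeff_c n k)" "jfun (base_coords n) (coeff_c n (k + 1))"
      using that n_ge_3 by (auto intro!: jfun_coeff_c)
    have cj: "jfun (base_coords n) (coeff_c n (k + j))" if "j \<in> {1..n - k}" for j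
      using that \<open>k \<le> n - 3\<close> n_ge_3 by (intro jfun_coeff_c) auto
    show ?thesis
      unfolding Xn_def vfield.simps divide_inverse
      by (intro jfun_const jfun_add jfun_diff jfun_mult jfun_minus jfun_sum c cj hj h0 inv x)
  qed
  ultimately show ?thesis by (simp add: vfield_on_def base_function_iff)
qed

text \<open>
  The coefficient of \<open>y\<^sup>(\<^sup>k\<^sup>-\<^sup>1\<^sup>)\<close> carries the factor \<open>n - k\<close>: the weight \<open>(n - 1) / 2\<close> in the \<open>y\<close>-component
  is exactly the one for which no such term survives at \<open>k = n\<close>. At \<open>k = 0\<close> the factor \<open>k\<close> removes the term
  in which \<open>k - 1\<close> is truncated.
\<close>

lemma prolong_Xn:
  assumes "p \<in> M"
  shows "k \<le> n \<Longrightarrow> prolong_coeff n (vf_x X) Dy (vf_y X) k p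
    = p (Dy k) * (k1 + ((real n - 1) / 2 - real k) * (2 * a2 * p Xvar + a1))
      + a2 * real k * (real n - real k) * p (Dy (k - 1)) + h_jet k p"
  using assms
proof (induction k arbitrary: p)
  case 0
  then show ?case by (simp add: Xn_def)
next
  case (Suc k)
  note p = Suc.prems(2)
  define r where "r = (real n - 1) / 2 - real k"
  let ?R = "\<lambda>p. p (Dy k) * (k1 + r * (2 * a2 * p Xvar + a1))
      + a2 * real k * (real n - real k) * p (Dy (k - 1)) + h_jet k p"
  note [simp] = smooth_add smooth_mult smooth_const smooth_coord smooth_fun_coord[OF h]
    smooth_fun_coord[OF h, of 0, simplified]
  have eq: "eqM (prolong_coeff n (vf_x X) Dy (vf_y X) k) ?R"
    using Suc by (simp add: eqM_def r_def)
  have hk: "total_deriv n (h_jet k) p = h_jet (Suc k) p"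
    using td_x[OF jfun_fun_coord[OF _ h] p] pd_fun_coord[OF h p] by simp
  have \<xi>: "total_deriv n (vf_x X) p = 2 * a2 * p Xvar + a1"
    unfolding Xn_def vfield.simps power2_eq_square
    using p by (simp add: td_add td_mult td_const td_Xvar algebra_simps)
  have "total_deriv n ?R p = p (Dy (Suc k)) * (k1 + r * (2 * a2 * p Xvar + a1)) + p (Dy k) * (r * (2 * a2))
      + a2 * real k * (real n - real k) * p (Dy k) + h_jet (Suc k) p"
    using p Suc.prems hk
    by (cases k) (simp_all add: td_add td_mult td_const td_Xvar td_Dy del: funpow.simps)
  then show ?case
    using td_cong'[OF eq p] \<xi> by (simp add: r_def field_simps)
qed

text \<open>
  After elimination of \<open>y\<^sup>(\<^sup>n\<^sup>)\<close> three groups of terms cancel separately: those with \<open>2 a\<^sub>2 x + a\<^sub>1\<close> between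
  \<open>\<eta>\<^sub>n\<close>, \<open>\<eta>\<^sub>k\<close> and \<open>\<phi>\<^sub>k\<close>; those with \<open>a\<^sub>2\<close> after a shift of the summation index; and those with \<open>h\<close>
  against the part of \<open>\<phi>\<^sub>0 y\<close> that contains \<open>h\<close>.
\<close>

lemma GS_generator_Xn: "GS_generator n M X"
  unfolding GS_generator_def
proof (intro conjI ballI impI vfield_on_Xn)
  fix p assume p: "p \<in> M" and on_shell: "LF_equation n p = 0"
  define s where "s = 2 * a2 * p Xvar + a1"
  define c where "c = (\<lambda>k. coeff_c n k p)"
  define y where "y = (\<lambda>k. p (Dy k))"
  define H where "H = (\<lambda>j. h_jet j p)"
  define S0 where "S0 = (\<Sum>k\<le>n - 3. c k * y k)"
  define S1 where "S1 = (\<Sum>k\<le>n - 3. real k * (c k * y k))"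
  define T where "T = (\<Sum>k\<le>n - 3. (real k + 1) * (real k + 1 - real n) * c (k + 1) * y k)"
  define U where "U = (\<Sum>k\<le>n - 3. c k * H k)"
  have y0: "y 0 \<noteq> 0"
    using coord_in[OF p, of "Dy 0"] Dy_0_nonzero by (auto simp: y_def)
  have yn: "y n = - S0"
    using on_shell by (simp add: LF_equation_def S0_def y_def c_def coeff_c_low cong: sum.cong_simp)
  have F: "prolong_coeff n (vf_x X) Dy (vf_y X) k p
      = y k * (k1 + ((real n - 1) / 2 - real k) * s) + a2 * real k * (real n - real k) * y (k - 1) + H k"
    if "k \<le> n" for k
    using prolong_Xn[OF p that] by (simp add: y_def s_def H_def)

  \<comment> \<open>the factor \<open>k\<close> removes the term at 0, and \<open>c\<^sub>n\<^sub>-\<^sub>2 = 0\<close> allows one more term at the top\<close>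
  have shift: "(\<Sum>k\<le>n - 3. real k * (real n - real k) * c k * y (k - 1)) = - T"
  proof -
    let ?f = "\<lambda>k. real k * (real n - real k) * c k * y (k - 1)"
    have "Suc (n - 3) = n - 2" using n_ge_3 by simp
    then have "?f (Suc (n - 3)) = 0"
      by (simp add: c_def coeff_c_high(1) del: of_nat_Suc)
    then have "(\<Sum>k\<le>n - 3. ?f k) = (\<Sum>k\<le>Suc (n - 3). ?f k)" by simp
    also have "\<dots> = ?f 0 + (\<Sum>k\<le>n - 3. ?f (Suc k))" by (rule sum.atMost_Suc_shift)
    also have "\<dots> = - T" by (simp add: T_def sum_negf[symmetric] algebra_simps)
    finally show ?thesis .
  qed
  \<comment> \<open>\<open>c\<^sub>n\<^sub>-\<^sub>2 = c\<^sub>n\<^sub>-\<^sub>1 = 0\<close> and \<open>c\<^sub>n = 1\<close>\<close>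
  have all_c: "(\<Sum>j\<le>n. c j * H j) = U + H n"
  proof -
    have "{..n} = {..n - 3} \<union> {n - 2, n - 1, n}" using n_ge_3 by auto
    then have "(\<Sum>j\<le>n. c j * H j) = U + (\<Sum>j\<in>{n - 2, n - 1, n}. c j * H j)"
      unfolding U_def using n_ge_3 by (simp only:) (rule sum.union_disjoint, auto)
    moreover have "n - 2 \<notin> {n - 1, n}" "n - 1 \<notin> {n}" using n_ge_3 by auto
    then have "(\<Sum>j\<in>{n - 2, n - 1, n}. c j * H j) = H n"
      unfolding c_def by (subst sum.insert; simp add: coeff_c_high[of p, simplified])
    ultimately show ?thesis by simp
  qed
  have \<phi>: "vf_c X k p * y k = - (real n - real k) * s * (c k * y k)
      + a2 * ((real k + 1) * (real k + 1 - real n) * c (k + 1) * y k) - (if k = 0 then U + H n else 0)"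
    if "k \<le> n - 3" for k
  proof -
    have "(- c 0 * (H 0 / y 0) - (\<Sum>j = 1..n. c j * (H j / y 0))) * y 0 = - (c 0 * H 0 + (\<Sum>j = 1..n. c j * H j))"
      using y0 by (simp add: left_diff_distrib sum_distrib_right)
    also have "c 0 * H 0 + (\<Sum>j = 1..n. c j * H j) = (\<Sum>j\<le>n. c j * H j)"
      by (simp add: atMost_atLeast0 sum.atLeast_Suc_atMost)
    finally show ?thesis
      unfolding all_c by (simp add: Xn_def c_def y_def H_def s_def algebra_simps)
  qed
  have "(\<Sum>k\<le>n - 3. vf_c X k p * y k) = - (real n * s * S0) + s * S1 + a2 * T - (U + H n)"
  proof -
    have "(\<Sum>k\<le>n - 3. vf_c X k p * y k) = (\<Sum>k\<le>n - 3. - (real n - real k) * s * (c k * y k)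
      + a2 * ((real k + 1) * (real k + 1 - real n) * c (k + 1) * y k) - (if k = 0 then U + H n else 0))"
      by (intro sum.cong refl) (simp add: \<phi>)
    also have "\<dots> = (\<Sum>k\<le>n - 3. - (real n * s) * (c k * y k) + s * (real k * (c k * y k))
      + a2 * ((real k + 1) * (real k + 1 - real n) * c (k + 1) * y k) - (if k = 0 then U + H n else 0))"
      by (intro sum.cong refl) (simp add: algebra_simps)
    also have "\<dots> = - (real n * s * S0) + s * S1 + a2 * T - (U + H n)"
      unfolding S0_def S1_def T_def by (simp only: sum.distrib sum_subtractf sum_distrib_left[symmetric]) simp
    finally show ?thesis .
  qed
  moreover have "(\<Sum>k\<le>n - 3. p (Dc k 0) * prolong_coeff n (vf_x X) Dy (vf_y X) k p)
      = (k1 + (real n - 1) / 2 * s) * S0 - s * S1 - a2 * T + U"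
  proof -
    have "(\<Sum>k\<le>n - 3. p (Dc k 0) * prolong_coeff n (vf_x X) Dy (vf_y X) k p)
      = (\<Sum>k\<le>n - 3. (k1 + (real n - 1) / 2 * s) * (c k * y k) - s * (real k * (c k * y k))
          + a2 * (real k * (real n - real k) * c k * y (k - 1)) + c k * H k)"
    proof (intro sum.cong refl)
      fix k assume "k \<in> {..n - 3}"
      then have k: "p (Dc k 0) = c k" "k \<le> n" using coeff_c_low n_ge_3 by (auto simp: c_def)
      show "p (Dc k 0) * prolong_coeff n (vf_x X) Dy (vf_y X) k p
        = (k1 + (real n - 1) / 2 * s) * (c k * y k) - s * (real k * (c k * y k))
          + a2 * (real k * (real n - real k) * c k * y (k - 1)) + c k * H k"
        unfolding k(1) F[OF k(2)] by (simp add: algebra_simps)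
    qed
    also have "\<dots> = (k1 + (real n - 1) / 2 * s) * S0 - s * S1 + a2 * (- T) + U"
      unfolding S0_def S1_def U_def shift[symmetric]
      by (simp only: sum.distrib sum_subtractf sum_distrib_left[symmetric])
    finally show ?thesis by simp
  qed
  moreover have "prolong_coeff n (vf_x X) Dy (vf_y X) n p
      = - S0 * (k1 + ((real n - 1) / 2 - real n) * s) + H n"
    using F[of n] yn by simp
  ultimately show "prolonged n X (LF_equation n) p = 0"
    unfolding prolonged_LF[OF p] by (simp add: y_def algebra_simps add_divide_distrib diff_divide_distrib)
qed

end

text \<open>
  The coefficient parts of two symmetries with the same \<open>\<xi>\<close> and \<open>\<eta>\<close> differ by \<open>d\<^sub>k\<close> with
  \<open>\<Sum>\<^sub>k d\<^sub>k y\<^sup>(\<^sup>k\<^sup>) = 0\<close>. Differentiation by \<open>y\<^sup>(\<^sup>k\<^sup>)\<close> isolates \<open>d\<^sub>k\<close> for \<open>k \<ge> 1\<close>; the term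
  \<open>d\<^sub>0 y\<close> is left, where \<open>y \<noteq> 0\<close>.
\<close>

lemma GS_determines_coefficients:
  assumes V: "GS_generator n M V" and W: "GS_generator n M W"
    and x: "eqM (vf_x V) (vf_x W)" and y: "eqM (vf_y V) (vf_y W)"
    and k: "k \<le> n - 3"
  shows "eqM (vf_c V k) (vf_c W k)"
proof -
  define d where "d = (\<lambda>k p. vf_c V k p - vf_c W k p)"
  have d: "jfun (order_le 0) (d k)" if "k \<le> n - 3" for k
  proof -
    have "jfun (base_coords n) (d k)"
      unfolding d_def using V W that
      by (intro jfun_diff) (auto simp: GS_generator_def vfield_on_def base_function_iff)
    then show ?thesis by (rule jfun_mono[OF _ base_coords_order])
  qed
  let ?G = "\<lambda>p. \<Sum>k\<le>n - 3. d k p * p (Dy k)"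
  have G: "?G p = 0" if "p \<in> M" for p
  proof (rule off_shell[OF _ _ _ that])
    show "jfun (order_le (n - 3)) ?G"
      by (intro jfun_sum jfun_mult jfun_coord jfun_mono[OF d]) auto
    show "Dy n \<notin> order_le (n - 3)" using n_ge_3 by auto
    fix p assume p: "p \<in> M" "LF_equation n p = 0"
    have "prolonged n V (LF_equation n) p = 0" "prolonged n W (LF_equation n) p = 0"
      using V W p by (auto simp: GS_generator_def)
    then show "?G p = 0"
      unfolding prolonged_LF[OF p(1)] using eqM_D[OF prolong_cong[OF x y] p(1)]
      by (simp add: d_def left_diff_distrib sum_subtractf)
  qed
  have pos: "d k p = 0" if k: "0 < k" "k \<le> n - 3" and p: "p \<in> M" for k p
  proof -
    have "pd (Dy k) ?G p = (\<Sum>j\<le>n - 3. pd (Dy k) (\<lambda>p. d j p * p (Dy j)) p)"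
      by (rule pd_smooth_sum[OF _ p]) (auto intro!: smooth_mult smooth_coord jfun_smooth[OF d])
    also have "\<dots> = (\<Sum>j\<le>n - 3. if j = k then d k p else 0)"
    proof (intro sum.cong refl)
      fix j assume j: "j \<in> {..n - 3}"
      then have "pd (Dy k) (d j) p = 0"
        using k(1) by (intro pd_absent[OF d _ p]) auto
      then show "pd (Dy k) (\<lambda>p. d j p * p (Dy j)) p = (if j = k then d k p else 0)"
        using j p by (simp add: pd_smooth_mult jfun_smooth[OF d] smooth_coord pd_coord)
    qed
    finally have "pd (Dy k) ?G p = d k p" using k(2) by simp
    moreover have "pd (Dy k) ?G p = pd (Dy k) (\<lambda>p. 0) p"
      by (rule pd_cong[OF _ p]) (simp add: eqM_def G)
    ultimately show ?thesis by (simp add: pd_const)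
  qed
  have "d k p = 0" if p: "p \<in> M" for p
  proof (cases "k = 0")
    case True
    have "?G p = (\<Sum>j\<le>n - 3. if j = 0 then d 0 p * p (Dy 0) else 0)"
      by (intro sum.cong refl) (auto simp: pos p)
    then have "d 0 p * p (Dy 0) = 0" using G[OF p] by simp
    moreover have "p (Dy 0) \<noteq> 0" using coord_in[OF p, of "Dy 0"] Dy_0_nonzero by auto
    ultimately show ?thesis using True by simp
  qed (use pos k p in simp)
  then show ?thesis by (simp add: eqM_def d_def)
qed

lemma GS_generator_iff:
  "GS_generator n M V \<longleftrightarrow>
    (\<exists>a0 a1 a2 k1 h. smooth_fun_on (B Xvar) h \<and> vfield_eq_on n M V (Xn n a0 a1 a2 k1 h))"
proof
  assume V: "GS_generator n M V"
  interpret LF_symmetry B M n "vf_x V" "vf_y V" "vf_c V"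
  proof
    show "jfun (base_coords n) (vf_x V)" "jfun (base_coords n) (vf_y V)"
      "\<And>k. k \<le> n - 3 \<Longrightarrow> jfun (base_coords n) (vf_c V k)"
      using V by (simp_all add: GS_generator_def vfield_on_def base_function_iff)
    fix p assume "p \<in> M" "LF_equation n p = 0"
    then show "prolong_coeff n (vf_x V) Dy (vf_y V) n p
        + (\<Sum>k\<le>n - 3. p (Dc k 0) * prolong_coeff n (vf_x V) Dy (vf_y V) k p)
        + (\<Sum>k\<le>n - 3. vf_c V k p * p (Dy k)) = 0"
      using V prolonged_LF[of p V] by (simp add: GS_generator_def)
  qed
  obtain a0 a1 a2 k1 h where h: "smooth_fun_on (B Xvar) h"
    and xy: "\<forall>p\<in>M. vf_x V p = a2 * (p Xvar)\<^sup>2 + a1 * p Xvar + a0 \<and>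
      vf_y V p = p (Dy 0) * (k1 + (real n - 1) / 2 * (2 * a2 * p Xvar + a1)) + h (p Xvar)"
    using explicit_\<xi>_\<eta> by blast
  have x': "eqM (vf_x V) (vf_x (Xn n a0 a1 a2 k1 h))" and y': "eqM (vf_y V) (vf_y (Xn n a0 a1 a2 k1 h))"
    by (simp_all add: eqM_def Xn_def xy)
  have "vfield_eq_on n M V (Xn n a0 a1 a2 k1 h)"
    using x' y' GS_determines_coefficients[OF V GS_generator_Xn[OF h] x' y']
    by (simp add: vfield_eq_on_def eqM_def)
  with h show "\<exists>a0 a1 a2 k1 h. smooth_fun_on (B Xvar) h \<and> vfield_eq_on n M V (Xn n a0 a1 a2 k1 h)"
    by blast
qed (use GS_cong GS_generator_Xn in blast)

end

section \<open>The box of jets over the domain\<close>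

definition LF_slices :: "nat \<Rightarrow> real set \<Rightarrow> real set \<Rightarrow> (nat \<Rightarrow> real set) \<Rightarrow> jet_coord \<Rightarrow> real set" where
  "LF_slices n I J K v = (case v of Xvar \<Rightarrow> I | Dy k \<Rightarrow> (if k = 0 then J else UNIV)
     | Dc i k \<Rightarrow> (if k = 0 \<and> i \<le> n - 3 then K i else UNIV))"

lemma jets_over_slices: "jets_over n I J K = {p. \<forall>v. p v \<in> LF_slices n I J K v}"
proof (intro set_eqI iffI)
  fix p assume "p \<in> jets_over n I J K"
  then have "p v \<in> LF_slices n I J K v" for v
    by (cases v) (auto simp: jets_over_def LF_slices_def)
  then show "p \<in> {p. \<forall>v. p v \<in> LF_slices n I J K v}" by simp
next
  fix p assume p: "p \<in> {p. \<forall>v. p v \<in> LF_slices n I J K v}"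
  then have slice: "p v \<in> LF_slices n I J K v" for v by simp
  have "p (Dc i 0) \<in> K i" if "i \<le> n - 3" for i
    using slice[of "Dc i 0"] that by (simp add: LF_slices_def)
  then show "p \<in> jets_over n I J K"
    using slice[of Xvar] slice[of "Dy 0"] by (simp add: jets_over_def LF_slices_def)
qed

lemma LF_box_jets_over:
  assumes "n \<ge> 3" "open_interval I" "open_interval J" "0 \<notin> J" "\<forall>i\<le>n - 3. open_interval (K i)"
  shows "LF_box (LF_slices n I J K) (jets_over n I J K) n"
proof
  have "open_interval (UNIV :: real set)"
    by (simp add: open_interval_def)
  then show "open_interval (LF_slices n I J K v)" for v
    using assms by (cases v) (auto simp: LF_slices_def)
qed (use assms in \<open>auto simp: LF_slices_def jets_over_slices\<close>)

section \<open>Infinitesimal generators of the equivalence group\<close>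

text \<open>
  Every transformation in \<open>G\<close> multiplies \<open>y\<close> by a factor depending on \<open>x\<close> only, so the velocity \<open>\<eta>\<close> is
  proportional to \<open>y\<close>.
\<close>

lemma G_generator_linear:
  assumes G: "G_generator n I J \<xi> \<eta>" and x: "x \<in> I" and y: "y1 \<in> J" "y2 \<in> J"
  shows "y2 * \<eta> x y1 = y1 * \<eta> x y2"
proof -
  obtain T :: "real \<Rightarrow> real \<Rightarrow> real" and \<mu> where T: "\<And>y. y \<in> J \<Longrightarrow>
      ((\<lambda>s. equivalence_map n (T s) (\<mu> s) (x, y)) has_vector_derivative (\<xi> x y, \<eta> x y)) (at 0)"
    using G x unfolding G_generator_def by meson
  define m where "m = (\<lambda>s. \<mu> s * deriv (T s) x powr ((real n - 1) / 2))"
  have m: "((\<lambda>s. m s * y) has_real_derivative \<eta> x y) (at 0)" if "y \<in> J" for y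
    using bounded_linear.has_vector_derivative[OF bounded_linear_snd T[OF that]]
    by (simp add: equivalence_map_def m_def has_real_derivative_iff_has_vector_derivative)
  have "((\<lambda>s. y2 * (m s * y1)) has_real_derivative y2 * \<eta> x y1) (at 0)"
    by (intro DERIV_cmult m y)
  moreover have "((\<lambda>s. y1 * (m s * y2)) has_real_derivative y1 * \<eta> x y2) (at 0)"
    by (intro DERIV_cmult m y)
  moreover have "(\<lambda>s. y2 * (m s * y1)) = (\<lambda>s. y1 * (m s * y2))"
    by (simp add: mult_ac)
  ultimately show ?thesis using DERIV_unique by metis
qed

lemma deriv_linear_fractional:
  assumes "\<gamma> * z + \<delta> \<noteq> 0"
  shows "deriv (linear_fractional \<alpha> \<beta> \<gamma> \<delta>) z = (\<alpha> * \<delta> - \<beta> * \<gamma>) / (\<gamma> * z + \<delta>)\<^sup>2"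
  unfolding linear_fractional_def
  by (rule DERIV_imp_deriv)
    (use assms in \<open>auto intro!: derivative_eq_intros simp: power2_eq_square algebra_simps\<close>)

lemma eventually_nonzero:
  fixes f :: "real \<Rightarrow> real"
  assumes "isCont f 0" "f 0 \<noteq> 0"
  shows "\<forall>\<^sub>F s in nhds 0. f s \<noteq> 0"
proof -
  have "(f \<longlongrightarrow> f 0) (nhds 0)"
    using assms(1) by (simp add: isCont_def tendsto_at_iff_tendsto_nhds)
  then show ?thesis using assms(2) by (rule tendsto_imp_eventually_ne)
qed

text \<open>
  The curve \<open>x \<mapsto> ((1 + s a\<^sub>1) x + s a\<^sub>0) / (1 - s a\<^sub>2 x)\<close> has velocity \<open>a\<^sub>2 x\<^sup>2 + a\<^sub>1 x + a\<^sub>0\<close> at \<open>s = 0\<close>, and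
  the logarithmic derivative of its Jacobian is \<open>2 a\<^sub>2 x + a\<^sub>1\<close>. The scaling factor can stay 1 because \<open>k\<^sub>1\<close>
  leaves no trace in the coefficient space.
\<close>

lemma G_generator_quadratic:
  "G_generator n I J (\<lambda>x y. a2 * x\<^sup>2 + a1 * x + a0) (\<lambda>x y. y * ((real n - 1) / 2 * (2 * a2 * x + a1)))"
proof -
  define \<alpha> where "\<alpha> = (\<lambda>s. 1 + s * a1)"
  define \<beta> where "\<beta> = (\<lambda>s. s * a0)"
  define \<gamma> where "\<gamma> = (\<lambda>s. - (s * a2))"
  define \<delta> :: "real \<Rightarrow> real" where "\<delta> = (\<lambda>s. 1)"
  define \<mu> :: "real \<Rightarrow> real" where "\<mu> = (\<lambda>s. 1)"
  note defs = \<alpha>_def \<beta>_def \<gamma>_def \<delta>_def \<mu>_def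
  define r where "r = (real n - 1) / 2"
  have smooth: "\<forall>f\<in>{\<alpha>, \<beta>, \<gamma>, \<delta>, \<mu>}. f differentiable at 0"
    unfolding defs by (auto intro!: derivative_intros)
  have det: "\<forall>\<^sub>F s in nhds 0. \<alpha> s * \<delta> s - \<beta> s * \<gamma> s \<noteq> 0 \<and> \<mu> s \<noteq> 0"
    using eventually_nonzero[of "\<lambda>s. \<alpha> s * \<delta> s - \<beta> s * \<gamma> s"] unfolding defs by simp
  have start: "equivalence_map n (linear_fractional (\<alpha> 0) (\<beta> 0) (\<gamma> 0) (\<delta> 0)) (\<mu> 0) = id"
    by (auto simp: equivalence_map_def linear_fractional_def[abs_def] defs fun_eq_iff)
  have velocity: "((\<lambda>s. equivalence_map n (linear_fractional (\<alpha> s) (\<beta> s) (\<gamma> s) (\<delta> s)) (\<mu> s) (x, y))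
      has_vector_derivative (a2 * x\<^sup>2 + a1 * x + a0, y * ((real n - 1) / 2 * (2 * a2 * x + a1)))) (at 0)" for x y
  proof -
    \<comment> \<open>\<open>?d\<close> is the derivative of \<open>?T\<close> by \<open>x\<close> where the denominator is nonzero, which holds for small \<open>s\<close>\<close>
    let ?T = "\<lambda>s. linear_fractional (\<alpha> s) (\<beta> s) (\<gamma> s) (\<delta> s)"
    let ?d = "\<lambda>s. (\<alpha> s * \<delta> s - \<beta> s * \<gamma> s) / (\<gamma> s * x + \<delta> s)\<^sup>2"
    have T: "((\<lambda>s. ?T s x) has_real_derivative a2 * x\<^sup>2 + a1 * x + a0) (at 0)"
      unfolding linear_fractional_def defs
      by (auto intro!: derivative_eq_intros simp: power2_eq_square algebra_simps)
    have "(?d has_real_derivative 2 * a2 * x + a1) (at 0)"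
      unfolding defs by (auto intro!: derivative_eq_intros simp: power2_eq_square algebra_simps)
    then have "((\<lambda>s. ?d s powr r) has_real_derivative r * ?d 0 powr (r - of_nat 1) * (2 * a2 * x + a1)) (at 0)"
      by (rule DERIV_fun_powr) (simp add: defs)
    then have d: "((\<lambda>s. \<mu> s * ?d s powr r * y) has_real_derivative y * (r * (2 * a2 * x + a1))) (at 0)"
      by (auto intro!: derivative_eq_intros simp: defs)
    have near: "\<forall>\<^sub>F s in nhds 0. \<mu> s * deriv (?T s) x powr r * y = \<mu> s * ?d s powr r * y"
    proof -
      have "\<forall>\<^sub>F s in nhds 0. \<gamma> s * x + \<delta> s \<noteq> 0"
        using eventually_nonzero[of "\<lambda>s. \<gamma> s * x + \<delta> s"] unfolding defs by simp
      then show ?thesis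
        by eventually_elim (simp add: deriv_linear_fractional)
    qed
    have w: "((\<lambda>s. \<mu> s * deriv (?T s) x powr r * y) has_real_derivative y * (r * (2 * a2 * x + a1))) (at 0)"
      by (rule DERIV_cong_ev[OF refl near refl, THEN iffD2, OF d])
    show ?thesis
      using has_vector_derivative_Pair[OF T[unfolded has_real_derivative_iff_has_vector_derivative]
          w[unfolded has_real_derivative_iff_has_vector_derivative]]
      by (simp add: equivalence_map_def r_def)
  qed
  show ?thesis
    unfolding G_generator_def
    by (rule exI[of _ \<alpha>], rule exI[of _ \<beta>], rule exI[of _ \<gamma>], rule exI[of _ \<delta>],
        rule exI[of _ \<mu>]) (intro conjI ballI smooth det start velocity)
qed

section \<open>Projection to the coefficient space\<close>

lemma iterated_deriv_zero:
  assumes "open I" "\<And>x. x \<in> I \<Longrightarrow> h x = (0::real)"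
  shows "x \<in> I \<Longrightarrow> (deriv ^^ j) h x = 0"
proof (induction j arbitrary: x)
  case (Suc j)
  have "\<forall>\<^sub>F t in nhds x. (deriv ^^ j) h t = 0"
    using eventually_nhds_in_open[OF assms(1) Suc.prems] by eventually_elim (rule Suc.IH)
  then have "deriv ((deriv ^^ j) h) x = deriv (\<lambda>t. 0) x"
    by (rule deriv_cong_ev) simp
  then show ?case by simp
qed (use assms in simp)

lemma Xn_zero_h_eq_Xn0:
  assumes "open I" "\<And>x. x \<in> I \<Longrightarrow> h x = 0"
  shows "vfield_eq_on n (jets_over n I J K) ((Xn n a0 a1 a2 k1 h)\<lparr>vf_y := \<lambda>p. 0\<rparr>) (Xn0 n a0 a1 a2)"
proof -
  have "h (p Xvar) = 0" "(deriv ^^ j) h (p Xvar) = 0" if "p \<in> jets_over n I J K" for p j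
    using that assms(2) iterated_deriv_zero[OF assms] by (auto simp: jets_over_def)
  then show ?thesis
    by (simp add: vfield_eq_on_def Xn_def Xn0_def)
qed

lemma vfield_eq_on_sym: "vfield_eq_on n M V W \<Longrightarrow> vfield_eq_on n M W V"
  by (simp add: vfield_eq_on_def)

lemma vfield_eq_on_trans: "vfield_eq_on n M U V \<Longrightarrow> vfield_eq_on n M V W \<Longrightarrow> vfield_eq_on n M U W"
  by (simp add: vfield_eq_on_def)

lemma vfield_eq_on_drop_y:
  "vfield_eq_on n M V W \<Longrightarrow> vfield_eq_on n M (V\<lparr>vf_y := \<lambda>p. 0\<rparr>) (W\<lparr>vf_y := \<lambda>p. 0\<rparr>)"
  by (simp add: vfield_eq_on_def)

text \<open>
  A function \<open>y \<mapsto> y a + h\<close> that is proportional to \<open>y\<close> on an interval has \<open>h = 0\<close>; two distinct values of \<open>y\<close>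
  suffice.
\<close>

lemma Gc_projection_h_zero:
  assumes V: "vfield_eq_on n (jets_over n I J K) V (Xn n a0 a1 a2 k1 h)"
    and G: "G_generator n I J \<xi> \<eta>"
    and \<eta>: "\<And>p. p \<in> jets_over n I J K \<Longrightarrow> vf_y V p = \<eta> (p Xvar) (p (Dy 0))"
    and J: "open_interval J" and K: "\<forall>i\<le>n - 3. open_interval (K i)" and x: "x \<in> I"
  shows "h x = 0"
proof -
  obtain y1 where y1: "y1 \<in> J" using J by (auto simp: open_interval_def)
  obtain e where e: "e > 0" "ball y1 e \<subseteq> J"
    using J y1 open_contains_ball unfolding open_interval_def by blast
  define y2 where "y2 = y1 + e / 2"
  have y2: "y2 \<in> J" using e by (auto simp: y2_def dist_real_def)
  have "\<forall>i. \<exists>t. i \<le> n - 3 \<longrightarrow> t \<in> K i" using K by (auto simp: open_interval_def)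
  then obtain c where c: "\<And>i. i \<le> n - 3 \<Longrightarrow> c i \<in> K i" by metis
  define a where "a = k1 + (real n - 1) / 2 * (2 * a2 * x + a1)"
  have \<eta>_eq: "\<eta> x y = y * a + h x" if "y \<in> J" for y
  proof -
    let ?p = "\<lambda>v. case v of Xvar \<Rightarrow> x | Dy k \<Rightarrow> y | Dc i k \<Rightarrow> c i"
    have p: "?p \<in> jets_over n I J K" using x that c by (simp add: jets_over_def)
    then show ?thesis
      using \<eta>[OF p] V by (simp add: vfield_eq_on_def Xn_def a_def)
  qed
  have "y2 * (y1 * a + h x) = y1 * (y2 * a + h x)"
    using G_generator_linear[OF G x y1 y2] by (simp add: \<eta>_eq y1 y2)
  then have "(y2 - y1) * h x = 0" by (simp add: algebra_simps)
  then show ?thesis using e by (simp add: y2_def)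
qed

theorem theorem3:
  fixes n :: nat and I J :: "real set" and K :: "nat \<Rightarrow> real set"
  assumes "n \<ge> 3"
    and "open_interval I" and "open_interval J" and "0 \<notin> J"
    and "\<forall>i\<le>n - 3. open_interval (K i)"
  shows "(\<forall>V. GS_generator n (jets_over n I J K) V \<longleftrightarrow>
            (\<exists>a0 a1 a2 k1 h. smooth_fun_on I h \<and>
               vfield_eq_on n (jets_over n I J K) V (Xn n a0 a1 a2 k1 h))) \<and>
         (\<forall>W. Gc_generator n I J K W \<longleftrightarrow>
            (\<exists>a0 a1 a2. vfield_eq_on n (jets_over n I J K) W (Xn0 n a0 a1 a2)))"
proof -
  interpret LF_box "LF_slices n I J K" "jets_over n I J K" n
    by (rule LF_box_jets_over[OF assms])
  let ?M = "jets_over n I J K"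
  have I: "LF_slices n I J K Xvar = I" by (simp add: LF_slices_def)
  have open_I: "open I" using assms(2) by (simp add: open_interval_def)
  have a: "GS_generator n ?M V \<longleftrightarrow> (\<exists>a0 a1 a2 k1 h. smooth_fun_on I h \<and>
      vfield_eq_on n ?M V (Xn n a0 a1 a2 k1 h))" for V
    using GS_generator_iff[of V] by (simp only: I)
  have b: "Gc_generator n I J K W \<longleftrightarrow> (\<exists>a0 a1 a2. vfield_eq_on n ?M W (Xn0 n a0 a1 a2))" for W
  proof
    assume "Gc_generator n I J K W"
    then obtain V \<xi> \<eta> where V: "GS_generator n ?M V" and G: "G_generator n I J \<xi> \<eta>"
      and proj: "\<And>p. p \<in> ?M \<Longrightarrow> vf_y V p = \<eta> (p Xvar) (p (Dy 0))"
      and W: "vfield_eq_on n ?M W (V\<lparr>vf_y := \<lambda>p. 0\<rparr>)"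
      unfolding Gc_generator_def by blast
    obtain a0 a1 a2 k1 h where Xn: "vfield_eq_on n ?M V (Xn n a0 a1 a2 k1 h)"
      using V a by blast
    have "h x = 0" if "x \<in> I" for x
      by (rule Gc_projection_h_zero[OF Xn G proj assms(3,5) that])
    then have "vfield_eq_on n ?M W (Xn0 n a0 a1 a2)"
      using vfield_eq_on_trans[OF W vfield_eq_on_trans[OF vfield_eq_on_drop_y[OF Xn]
            Xn_zero_h_eq_Xn0[OF open_I]]] by blast
    then show "\<exists>a0 a1 a2. vfield_eq_on n ?M W (Xn0 n a0 a1 a2)" by blast
  next
    assume "\<exists>a0 a1 a2. vfield_eq_on n ?M W (Xn0 n a0 a1 a2)"
    then obtain a0 a1 a2 where W: "vfield_eq_on n ?M W (Xn0 n a0 a1 a2)" by blast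
    let ?V = "Xn n a0 a1 a2 0 (\<lambda>x. 0)"
    have "(deriv ^^ j) (\<lambda>x. 0) = (\<lambda>x. 0 :: real)" for j
      using iterated_deriv_zero[of UNIV "\<lambda>x. 0"] by auto
    then have "smooth_fun_on I (\<lambda>x. 0)" by (simp add: smooth_fun_on_def)
    then have "GS_generator n ?M ?V"
      unfolding a vfield_eq_on_def by blast
    moreover have "vfield_eq_on n ?M W (?V\<lparr>vf_y := \<lambda>p. 0\<rparr>)"
      by (rule vfield_eq_on_trans[OF W vfield_eq_on_sym[OF Xn_zero_h_eq_Xn0[OF open_I]]]) simp
    moreover have "vf_x ?V p = (\<lambda>x y. a2 * x\<^sup>2 + a1 * x + a0) (p Xvar) (p (Dy 0))"
      "vf_y ?V p = (\<lambda>x y. y * ((real n - 1) / 2 * (2 * a2 * x + a1))) (p Xvar) (p (Dy 0))" for p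
      by (simp_all add: Xn_def)
    ultimately show "Gc_generator n I J K W"
      unfolding Gc_generator_def using G_generator_quadratic by blast
  qed
  show ?thesis using a b by blast
qed

end
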